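(* Let $0\le t<1$ and $N\ge1$. Let $\lambda,\mu,\nu,\rho\in\mathrm{Sig}_N$ with $\lambda\prec\mu\prec\rho$, $\lambda\prec\nu\prec\rho$ and $|\nu|-|\lambda|=|\rho|-|\mu|$. Then $$U(\mu\to\rho\mid\lambda\to\nu)\,\frac{\phi_{\nu/\lambda}\,\psi_{\mu/\lambda}}{\phi_{\rho/\mu}\,\psi_{\rho/\nu}}=U(-\nu\to-\lambda\mid-\rho\to-\mu),$$ where for a signature $\kappa=(\kappa_1,\dots,\kappa_N)$ one writes $-\kappa:=(-\kappa_N,\dots,-\kappa_1)$, and $U,\phi,\psi$ are defined in the context.
   Context: A signature of length $N$ is a sequence of integers $\lambda_1\ge\dots\ge\lambda_N$; $\mathrm{Sig}_N$ is the set of these and $|\lambda|=\lambda_1+\dots+\lambda_N$; conventions: $\lambda_k=-\infty$ for $k>N$ and $\lambda_0=+\infty$. For $\lambda,\mu\in\mathrm{Sig}_N$ write $\lambda\prec\mu$ if $\mu_1\ge\lambda_1\ge\mu_2\ge\lambda_2\ge\dots\ge\mu_N\ge\lambda_N$. For $\lambda,\mu\in\mathrm{Sig}_N$ set $$\psi_{\mu/\lambda}=\mathbf 1_{\lambda\prec\mu}\prod_{1\le k\le j\le N:\ \mu_{j+1}<\lambda_j=\lambda_k<\mu_k}(1-t^{j-k+1}),\qquad \phi_{\mu/\lambda}=\mathbf 1_{\lambda\prec\mu}\prod_{1\le k\le j\le N:\ \lambda_j<\mu_j=\mu_k<\lambda_{k-1}}(1-t^{j-k+1}).$$ A signature $\kappa$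 is viewed as $N$ particles on $\mathbb Z$ at positions $\kappa_1,\dots,\kappa_N$; moving a particle at position $k$ by $+1$ means replacing one coordinate equal to $k$ by $k+1$ (and reordering). Definition of $U(\mu\to\rho\mid\lambda\to\nu)$. It is $0$ unless $\lambda\prec\mu\prec\rho$, $\lambda\prec\nu\prec\rho$ and $|\nu|-|\lambda|=|\rho|-|\mu|$. Otherwise put $m=|\nu|-|\lambda|$, $n=|\mu|-|\lambda|$, and consider functions $\Lambda:\{0,\dots,m\}\times\{0,\dots,n\}\to\mathrm{Sig}_N$ with $\Lambda(0,0)=\lambda$, $\Lambda(m,0)=\nu$, $\Lambda(0,n)=\mu$, $\Lambda(m,n)=\rho$ such that: $\Lambda(i+1,j)$ is obtained from $\Lambda(i,j)$ by moving one particle, at position denoted $h_{i,j}$, by $+1$; $\Lambda(i,j+1)$ is obtained from $\Lambda(i,j)$ by moving one particle, at position denoted $v_{i,j}$, by $+1$; $h_{i,j}<h_{i+1,j}$ and $v_{i,j}<v_{i,j+1}$ whenever defined; and whenever $h_{i,j}=v_{i,j}=k$ (with $0\le i<m$, $0\le j<n$), one has $h_{i,j+1}=v_{i+1,j}\in\{k,k+1\}$. Such $\Lambda$ is called admissible; at most one exists. If none exists, $U:=0$. If it exists, let $b_{i,j}$ ($0\le i<m$, $0\le j<n$) be the unit box with south-west corner $(i,j)$. It is a zero-box if $h_{i,j}=v_{i,j}=h_{i,j+1}=v_{i+1,j}$; a one-box if $h_{i,j}=v_{i,j}=h_{i,j+1}-1=v_{i+1,j}-1$; and otherwise trivial (then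 $h_{i,j}=h_{i,j+1}\ne v_{i,j}=v_{i+1,j}$). Boxes outside the rectangle are considered trivial, and $h_{-1,j}=v_{i,-1}=-\infty$. For a zero-box or one-box $B=b_{i,j}$ put $r(B)=h_{i,j}=v_{i,j}$, $\bar r(B)=h_{i,j+1}=v_{i+1,j}$, and $c(B)=t^{\#}$, where $\#$ is the number of coordinates of $\Lambda(i,j)$ equal to $r(B)$. The weight $w(B)$ of $B=b_{i,j}$ is: (1) $w(B)=1$ if $B$ is trivial; or $B$ is a one-box and at least one of $b_{i-1,j},b_{i,j-1}$ is a one-box; or $B$ is a one-box and $b_{i-1,j-1}$ is a one-box with $\bar r(b_{i-1,j-1})=r(B)-1$; or $B$ is a zero-box and $b_{i-1,j-1}$ is a zero-box with $\bar r(b_{i-1,j-1})=r(B)-1$; (2) $w(B)=t$ if $B$ is a zero-box and exactly one of $h_{i-1,j},v_{i,j-1}$ equals $r(B)-1$; (3) $w(B)=1-t$ if $B$ is a one-box, $b_{i-1,j}$ and $b_{i,j-1}$ are trivial, and exactly one of $h_{i-1,j},v_{i,j-1}$ equals $r(B)-1$; (4) $w(B)=\frac{t-c(B)}{1-c(B)}$ if $B$ is a zero-box and $h_{i-1,j},v_{i,j-1}<r(B)-1$; (5) $w(B)=\frac{1-t}{1-c(B)}$ if $B$ is a one-box and $h_{i-1,j},v_{i,j-1}<r(B)-1$; (6) $w(B)=0$ if $B$ is a one-box and $b_{i-1,j-1}$ is a zero-box with $\bar r(b_{i-1,j-1})=r(B)-1$, or $B$ is a zero-box and $b_{i-1,j-1}$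 is a one-box with $\bar r(b_{i-1,j-1})=r(B)-1$. Finally $U(\mu\to\rho\mid\lambda\to\nu):=\prod_{i=0}^{m-1}\prod_{j=0}^{n-1}w(b_{i,j})$. *)

theory Defs
  imports Complex_Main "HOL-Library.Multiset" "HOL-Library.Extended"
begin

type_synonym sig = "int list"

definition Sig :: "nat \<Rightarrow> sig set" where
  "Sig N = {\<kappa>. length \<kappa> = N \<and> sorted_wrt (\<ge>) \<kappa>}"

(* Parts are numbered from 1, with part 0 equal to +infinity and parts beyond the length
   equal to -infinity. *)
definition part :: "sig \<Rightarrow> nat \<Rightarrow> int extended" where
  "part \<kappa> k = (if k = 0 then Pinf else if k \<le> length \<kappa> then Fin (\<kappa> ! (k - 1)) else Minf)"

definition weight :: "sig \<Rightarrow> int" where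
  "weight \<kappa> = sum_list \<kappa>"

definition neg :: "sig \<Rightarrow> sig" where
  "neg \<kappa> = map uminus (rev \<kappa>)"

definition interlaces :: "sig \<Rightarrow> sig \<Rightarrow> bool" where
  "interlaces \<kappa> \<mu> \<longleftrightarrow> length \<kappa> = length \<mu> \<and>
     (\<forall>k\<in>{1..length \<mu>}. part \<mu> k \<ge> part \<kappa> k \<and> part \<kappa> k \<ge> part \<mu> (k + 1))"

(* psi N t \<mu> \<kappa> is \<psi> indexed by \<mu>/\<kappa>; the skew pair is written in the same order in phi. *)
definition psi :: "nat \<Rightarrow> real \<Rightarrow> sig \<Rightarrow> sig \<Rightarrow> real" where
  "psi N t \<mu> \<kappa> = (if interlaces \<kappa> \<mu> then
     (\<Prod>(k, j) \<in> {(k, j). 1 \<le> k \<and> k \<le> j \<and> j \<le> N \<and>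
          part \<mu> (j + 1) < part \<kappa> j \<and> part \<kappa> j = part \<kappa> k \<and> part \<kappa> k < part \<mu> k}.
        1 - t ^ (j - k + 1)) else 0)"

definition phi :: "nat \<Rightarrow> real \<Rightarrow> sig \<Rightarrow> sig \<Rightarrow> real" where
  "phi N t \<mu> \<kappa> = (if interlaces \<kappa> \<mu> then
     (\<Prod>(k, j) \<in> {(k, j). 1 \<le> k \<and> k \<le> j \<and> j \<le> N \<and>
          part \<kappa> j < part \<mu> j \<and> part \<mu> j = part \<mu> k \<and> part \<mu> k < part \<kappa> (k - 1)}.
        1 - t ^ (j - k + 1)) else 0)"

(* Move one particle at position k by +1 (for signatures, which are determined by their
   multisets of coordinates). *)
definition moves :: "int \<Rightarrow> sig \<Rightarrow> sig \<Rightarrow> bool" where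
  "moves k \<kappa> \<kappa>' \<longleftrightarrow> k \<in># mset \<kappa> \<and> mset \<kappa>' = add_mset (k + 1) (mset \<kappa> - {#k#})"

definition moved_pos :: "sig \<Rightarrow> sig \<Rightarrow> int" where
  "moved_pos \<kappa> \<kappa>' = (THE k. moves k \<kappa> \<kappa>')"

(* Grid indices are integers, so that i - 1 and j - 1 keep their meaning on the boundary;
   only the values for 0 <= i <= m and 0 <= j <= n matter. *)
type_synonym array = "int \<Rightarrow> int \<Rightarrow> sig"

definition hpos :: "array \<Rightarrow> int \<Rightarrow> int \<Rightarrow> int" where
  "hpos \<Lambda> i j = moved_pos (\<Lambda> i j) (\<Lambda> (i + 1) j)"

definition vpos :: "array \<Rightarrow> int \<Rightarrow> int \<Rightarrow> int" where
  "vpos \<Lambda> i j = moved_pos (\<Lambda> i j) (\<Lambda> i (j + 1))"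

definition hpos_ext :: "array \<Rightarrow> int \<Rightarrow> int \<Rightarrow> int extended" where
  "hpos_ext \<Lambda> i j = (if i < 0 then Minf else Fin (hpos \<Lambda> i j))"

definition vpos_ext :: "array \<Rightarrow> int \<Rightarrow> int \<Rightarrow> int extended" where
  "vpos_ext \<Lambda> i j = (if j < 0 then Minf else Fin (vpos \<Lambda> i j))"

definition admissible ::
  "nat \<Rightarrow> int \<Rightarrow> int \<Rightarrow> sig \<Rightarrow> sig \<Rightarrow> sig \<Rightarrow> sig \<Rightarrow> array \<Rightarrow> bool" where
  "admissible N m n \<mu> \<rho> \<kappa> \<nu> \<Lambda> \<longleftrightarrow>
     (\<forall>i\<in>{0..m}. \<forall>j\<in>{0..n}. \<Lambda> i j \<in> Sig N) \<and>
     \<Lambda> 0 0 = \<kappa> \<and> \<Lambda> m 0 = \<nu> \<and> \<Lambda> 0 n = \<mu> \<and> \<Lambda> m n = \<rho> \<and>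
     (\<forall>i\<in>{0..<m}. \<forall>j\<in>{0..n}. \<exists>k. moves k (\<Lambda> i j) (\<Lambda> (i + 1) j)) \<and>
     (\<forall>i\<in>{0..m}. \<forall>j\<in>{0..<n}. \<exists>k. moves k (\<Lambda> i j) (\<Lambda> i (j + 1))) \<and>
     (\<forall>i\<in>{0..<m - 1}. \<forall>j\<in>{0..n}. hpos \<Lambda> i j < hpos \<Lambda> (i + 1) j) \<and>
     (\<forall>i\<in>{0..m}. \<forall>j\<in>{0..<n - 1}. vpos \<Lambda> i j < vpos \<Lambda> i (j + 1)) \<and>
     (\<forall>i\<in>{0..<m}. \<forall>j\<in>{0..<n}. \<forall>k. hpos \<Lambda> i j = k \<and> vpos \<Lambda> i j = k \<longrightarrow>
        hpos \<Lambda> i (j + 1) = vpos \<Lambda> (i + 1) j \<and> hpos \<Lambda> i (j + 1) \<in> {k, k + 1})"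

definition zero_box :: "int \<Rightarrow> int \<Rightarrow> array \<Rightarrow> int \<Rightarrow> int \<Rightarrow> bool" where
  "zero_box m n \<Lambda> i j \<longleftrightarrow> 0 \<le> i \<and> i < m \<and> 0 \<le> j \<and> j < n \<and>
     hpos \<Lambda> i j = vpos \<Lambda> i j \<and> hpos \<Lambda> i (j + 1) = hpos \<Lambda> i j \<and>
     vpos \<Lambda> (i + 1) j = hpos \<Lambda> i j"

definition one_box :: "int \<Rightarrow> int \<Rightarrow> array \<Rightarrow> int \<Rightarrow> int \<Rightarrow> bool" where
  "one_box m n \<Lambda> i j \<longleftrightarrow> 0 \<le> i \<and> i < m \<and> 0 \<le> j \<and> j < n \<and>
     hpos \<Lambda> i j = vpos \<Lambda> i j \<and> hpos \<Lambda> i (j + 1) - 1 = hpos \<Lambda> i j \<and>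
     vpos \<Lambda> (i + 1) j - 1 = hpos \<Lambda> i j"

definition trivial_box :: "int \<Rightarrow> int \<Rightarrow> array \<Rightarrow> int \<Rightarrow> int \<Rightarrow> bool" where
  "trivial_box m n \<Lambda> i j \<longleftrightarrow> \<not> zero_box m n \<Lambda> i j \<and> \<not> one_box m n \<Lambda> i j"

(* r and rbar are meant for zero-boxes and one-boxes only. *)
definition box_r :: "array \<Rightarrow> int \<Rightarrow> int \<Rightarrow> int" where
  "box_r \<Lambda> i j = hpos \<Lambda> i j"

definition box_rbar :: "array \<Rightarrow> int \<Rightarrow> int \<Rightarrow> int" where
  "box_rbar \<Lambda> i j = hpos \<Lambda> i (j + 1)"

definition box_c :: "real \<Rightarrow> array \<Rightarrow> int \<Rightarrow> int \<Rightarrow> real" where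
  "box_c t \<Lambda> i j = t ^ count (mset (\<Lambda> i j)) (box_r \<Lambda> i j)"

(* For an admissible array the six defining conditions are mutually exclusive and exhaustive,
   so their order is immaterial; the last branch is the weight-0 case: a one-box (zero-box)
   whose south-west neighbour (i - 1, j - 1) is a zero-box (one-box) with rbar = r - 1.
   In the exactly-one conditions, inequality of Booleans is exclusive or. *)
definition box_weight :: "real \<Rightarrow> int \<Rightarrow> int \<Rightarrow> array \<Rightarrow> int \<Rightarrow> int \<Rightarrow> real" where
  "box_weight t m n \<Lambda> i j =
    (let Z = zero_box m n \<Lambda>; O1 = one_box m n \<Lambda>; T = trivial_box m n \<Lambda>;
         r = box_r \<Lambda> i j; c = box_c t \<Lambda> i j;
         h = hpos_ext \<Lambda> (i - 1) j; v = vpos_ext \<Lambda> i (j - 1);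
         diag = (box_rbar \<Lambda> (i - 1) (j - 1) = r - 1)
     in if T i j \<or>
           O1 i j \<and> (O1 (i - 1) j \<or> O1 i (j - 1)) \<or>
           O1 i j \<and> O1 (i - 1) (j - 1) \<and> diag \<or>
           Z i j \<and> Z (i - 1) (j - 1) \<and> diag then 1
        else if Z i j \<and> (h = Fin (r - 1)) \<noteq> (v = Fin (r - 1)) then t
        else if O1 i j \<and> T (i - 1) j \<and> T i (j - 1) \<and>
           (h = Fin (r - 1)) \<noteq> (v = Fin (r - 1)) then 1 - t
        else if Z i j \<and> h < Fin (r - 1) \<and> v < Fin (r - 1) then (t - c) / (1 - c)
        else if O1 i j \<and> h < Fin (r - 1) \<and> v < Fin (r - 1) then (1 - t) / (1 - c)
        else 0)"

(* U N t \<mu> \<rho> \<kappa> \<nu> is U(\<mu> -> \<rho> | \<kappa> -> \<nu>).  An admissible array is unique on the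
   rectangle and the product uses only its values there, so the choice is immaterial. *)
definition U :: "nat \<Rightarrow> real \<Rightarrow> sig \<Rightarrow> sig \<Rightarrow> sig \<Rightarrow> sig \<Rightarrow> real" where
  "U N t \<mu> \<rho> \<kappa> \<nu> =
    (let m = weight \<nu> - weight \<kappa>; n = weight \<mu> - weight \<kappa> in
     if interlaces \<kappa> \<mu> \<and> interlaces \<mu> \<rho> \<and> interlaces \<kappa> \<nu> \<and> interlaces \<nu> \<rho> \<and>
        weight \<nu> - weight \<kappa> = weight \<rho> - weight \<mu> \<and>
        (\<exists>\<Lambda>. admissible N m n \<mu> \<rho> \<kappa> \<nu> \<Lambda>)
     then let \<Lambda> = (SOME \<Lambda>. admissible N m n \<mu> \<rho> \<kappa> \<nu> \<Lambda>)
          in \<Prod>i\<in>{0..<m}. \<Prod>j\<in>{0..<n}. box_weight t m n \<Lambda> i j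
     else 0)"

end

theory Submission
  imports Defs
begin

text \<open>
The array behind \<open>U(-\<nu> \<rightarrow> -\<lambda> | -\<rho> \<rightarrow> -\<mu>)\<close> is the array \<open>\<Lambda>\<close> behind
\<open>U(\<mu> \<rightarrow> \<rho> | \<lambda> \<rightarrow> \<nu>)\<close>, negated and turned by half a turn. Zero-boxes stay zero-boxes and
one-boxes stay one-boxes, but the weights of the turned array, read in \<open>\<Lambda>\<close>, consult the
north-east neighbours of a box instead of its south-west neighbours. The claim therefore compares
two products over the boxes of one and the same array.

Write \<open>[c]\<close> for \<open>1 - t^c\<close>, and let \<open>c\<close> be the number of particles at the position \<open>r\<close> of a
non-trivial box. Its weight splits into three parts: a factor \<open>t\<close> for a zero-box that does not
continue a diagonal of zero-boxes; a factor \<open>1 - t\<close> for a one-box without a one-box directly to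
the left, below, or diagonally before it; and \<open>G\<close>, equal to \<open>[c-1]/[c]\<close> for a zero-box and
\<open>1/[c]\<close> for a one-box, which is present only if neither incoming edge sits at \<open>r - 1\<close>. The only
exception is the weight 0 of a box that follows a box of the other kind diagonally; then
the first of the two has weight 0 in the turned array, and both products vanish.

The first two parts have equal products because diagonal chains of zero-boxes, and clusters of
one-boxes, have as many beginnings as ends (\<open>t_exponent\<close>, \<open>one_minus_t_exponent\<close>). For the third
part, \<open>G\<close> is inverted once for each of the two incoming edges at \<open>r - 1\<close> and restored if both
are there. So its product is the product of all \<open>G\<close>, divided by the \<open>G\<close> of the boxes hit from
the left and by the \<open>G\<close> of the boxes hit from below, times the \<open>G\<close> of the boxes hit by both.
Each of these four products is compared with its north-east counterpart by a purely local relation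
(\<open>box_exchange\<close>, \<open>adjacent_exchange\<close>, \<open>adjacent_exchange_v\<close>, \<open>diagonal_exchange\<close>), and the
relations telescope to factors on the boundary of the rectangle (\<open>boundary_balance\<close>).

These boundary factors are the skew coefficients: \<open>\<phi>\<close> is the product of \<open>[m]\<close> over the positions
at which the number of particles rises to \<open>m\<close>, and \<open>\<psi>\<close> the product over the positions at
which it falls from \<open>m\<close> (\<open>phi_by_positions\<close>, \<open>psi_by_positions\<close>). Along a chain of moves
at increasing positions, a rise at \<open>x\<close> is a move from \<open>x - 1\<close> not followed by a move from \<open>x\<close>,
so both coefficients become products over boundary edges.
\<close>

section \<open>Products over integer intervals\<close>

lemma prod_int_telescope:
  fixes f :: "int \<Rightarrow> real"
  assumes "0 \<le> n" and "\<And>j. 0 \<le> j \<Longrightarrow> j \<le> n \<Longrightarrow> f j \<noteq> 0"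
  shows "(\<Prod>j\<in>{0..<n}. f (j + 1) / f j) = f n / f 0"
  using assms
proof (induction n rule: int_ge_induct)
  case base
  then show ?case by simp
next
  case (step n)
  have "{0..<n + 1} = insert n {0..<n}" using step(1) by auto
  then show ?case using step by simp
qed

lemma prod_int_shift:
  fixes f :: "int \<Rightarrow> 'a :: comm_monoid_mult"
  assumes "f (-1) = 1" and "f (m - 1) = 1"
  shows "(\<Prod>i\<in>{0..<m}. f (i - 1)) = (\<Prod>i\<in>{0..<m}. f i)"
proof (cases "0 < m")
  case True
  have "(\<Prod>i\<in>{0..<m}. f (i - 1)) = prod f {-1..<m - 1}"
    by (rule prod.reindex_bij_witness[of _ "\<lambda>i. i + 1" "\<lambda>i. i - 1"]) auto
  also have "{-1..<m - 1} = insert (-1) {0..<m - 1}" using True by auto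
  also have "prod f \<dots> = prod f (insert (m - 1) {0..<m - 1})" using assms by simp
  also have "insert (m - 1) {0..<m - 1} = {0..<m}" using True by auto
  finally show ?thesis .
qed simp

lemma sum_int_shift:
  fixes f :: "int \<Rightarrow> 'a :: comm_monoid_add"
  assumes "f (-1) = 0" and "f (m - 1) = 0"
  shows "(\<Sum>i\<in>{0..<m}. f (i - 1)) = (\<Sum>i\<in>{0..<m}. f i)"
proof (cases "0 < m")
  case True
  have "(\<Sum>i\<in>{0..<m}. f (i - 1)) = sum f {-1..<m - 1}"
    by (rule sum.reindex_bij_witness[of _ "\<lambda>i. i + 1" "\<lambda>i. i - 1"]) auto
  also have "{-1..<m - 1} = insert (-1) {0..<m - 1}" using True by auto
  also have "sum f \<dots> = sum f (insert (m - 1) {0..<m - 1})" using assms by simp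
  also have "insert (m - 1) {0..<m - 1} = {0..<m}" using True by auto
  finally show ?thesis .
qed simp

lemma double_sum_shift:
  fixes f :: "int \<Rightarrow> int \<Rightarrow> 'a :: comm_monoid_add"
  assumes "\<And>j. f (-1) j = 0" "\<And>j. f (m - 1) j = 0" "\<And>i. f i (-1) = 0" "\<And>i. f i (n - 1) = 0"
  shows "(\<Sum>i\<in>{0..<m}. \<Sum>j\<in>{0..<n}. f (i - 1) (j - 1)) = (\<Sum>i\<in>{0..<m}. \<Sum>j\<in>{0..<n}. f i j)"
proof -
  have "(\<Sum>i\<in>{0..<m}. \<Sum>j\<in>{0..<n}. f (i - 1) (j - 1)) = (\<Sum>i\<in>{0..<m}. \<Sum>j\<in>{0..<n}. f (i - 1) j)"
    by (intro sum.cong refl sum_int_shift assms)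
  also have "\<dots> = (\<Sum>i\<in>{0..<m}. \<Sum>j\<in>{0..<n}. f i j)"
    by (rule sum_int_shift) (simp_all add: assms)
  finally show ?thesis .
qed

lemma double_prod_shift:
  fixes f :: "int \<Rightarrow> int \<Rightarrow> 'a :: comm_monoid_mult"
  assumes "\<And>j. f (-1) j = 1" "\<And>j. f (m - 1) j = 1" "\<And>i. f i (-1) = 1" "\<And>i. f i (n - 1) = 1"
  shows "(\<Prod>i\<in>{0..<m}. \<Prod>j\<in>{0..<n}. f (i - 1) (j - 1)) = (\<Prod>i\<in>{0..<m}. \<Prod>j\<in>{0..<n}. f i j)"
proof -
  have "(\<Prod>i\<in>{0..<m}. \<Prod>j\<in>{0..<n}. f (i - 1) (j - 1)) = (\<Prod>i\<in>{0..<m}. \<Prod>j\<in>{0..<n}. f (i - 1) j)"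
    by (intro prod.cong refl prod_int_shift assms)
  also have "\<dots> = (\<Prod>i\<in>{0..<m}. \<Prod>j\<in>{0..<n}. f i j)"
    by (rule prod_int_shift) (simp_all add: assms)
  finally show ?thesis .
qed

text \<open>
The form in which all local relations are summed up: \<open>f\<close> sits on the edges between consecutive
boxes, \<open>g\<close> and \<open>k\<close> inside the boxes. It serves in both directions of the grid.
\<close>

lemma prod_telescope:
  fixes f g k :: "int \<Rightarrow> real"
  assumes "0 \<le> n" and nz: "\<And>j. 0 \<le> j \<Longrightarrow> j \<le> n \<Longrightarrow> f j \<noteq> 0"
    and eq: "\<And>j. 0 \<le> j \<Longrightarrow> j < n \<Longrightarrow> f j * g j = f (j + 1) * k j"
  shows "f 0 * (\<Prod>j\<in>{0..<n}. g j) = f n * (\<Prod>j\<in>{0..<n}. k j)"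
proof -
  have "(\<Prod>j\<in>{0..<n}. g j) = (\<Prod>j\<in>{0..<n}. f (j + 1) / f j * k j)"
  proof (rule prod.cong)
    fix j assume "j \<in> {0..<n}"
    then show "g j = f (j + 1) / f j * k j" using eq[of j] nz[of j] by (simp add: field_simps)
  qed simp
  also have "\<dots> = f n / f 0 * (\<Prod>j\<in>{0..<n}. k j)"
    unfolding prod.distrib using prod_int_telescope[of n f] assms by simp
  finally show ?thesis using nz[of 0] \<open>0 \<le> n\<close> by simp
qed

lemma prod_int_reverse:
  fixes f :: "int \<Rightarrow> 'a :: comm_monoid_mult"
  shows "(\<Prod>i\<in>{0..<m}. f i) = (\<Prod>i\<in>{0..<m}. f (m - 1 - i))"
  by (rule prod.reindex_bij_witness[of _ "\<lambda>i. m - 1 - i" "\<lambda>i. m - 1 - i"]) auto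

lemma double_prod_reverse:
  fixes f :: "int \<Rightarrow> int \<Rightarrow> 'a :: comm_monoid_mult"
  shows "(\<Prod>i\<in>{0..<m}. \<Prod>j\<in>{0..<n}. f i j) = (\<Prod>i\<in>{0..<m}. \<Prod>j\<in>{0..<n}. f (m - 1 - i) (n - 1 - j))"
proof -
  have "(\<Prod>i\<in>{0..<m}. \<Prod>j\<in>{0..<n}. f i j) = (\<Prod>i\<in>{0..<m}. \<Prod>j\<in>{0..<n}. f i (n - 1 - j))"
    by (intro prod.cong refl prod_int_reverse)
  also have "\<dots> = (\<Prod>i\<in>{0..<m}. \<Prod>j\<in>{0..<n}. f (m - 1 - i) (n - 1 - j))"
    by (rule prod_int_reverse)
  finally show ?thesis .
qed

section \<open>Grids of particle moves\<close>

text \<open>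
The function \<open>\<lambda>x. of_bool (x = a + 1) - of_bool (x = a)\<close> is the effect on the particle numbers
of a move from \<open>a\<close>. These functions are linearly independent, so two pairs of moves with the
same total effect agree as multisets.
\<close>

lemma commuting_moves:
  fixes h v h' v' :: int
  assumes "\<And>x. (of_bool (x = h + 1) - of_bool (x = h) + of_bool (x = v' + 1) - of_bool (x = v') :: int)
     = of_bool (x = v + 1) - of_bool (x = v) + of_bool (x = h' + 1) - of_bool (x = h')"
  shows "h = h' \<and> v = v' \<or> h = v \<and> h' = v'"
proof -
  have single: "a = b"
    if "\<And>x. (of_bool (x = a + 1) - of_bool (x = a) :: int) = of_bool (x = b + 1) - of_bool (x = b)"
    for a b :: int
    using that[of "a + 1"] by (cases "a + 1 = b"; cases "a = b"; simp)
  consider "h = h'" | "h = v" | "h \<noteq> h'" "h \<noteq> v" by blast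
  then show ?thesis
  proof cases
    case 1
    have "v' = v"
    proof (rule single)
      fix x
      show "(of_bool (x = v' + 1) - of_bool (x = v') :: int) = of_bool (x = v + 1) - of_bool (x = v)"
        using assms[of x] unfolding 1 by linarith
    qed
    with 1 show ?thesis by simp
  next
    case 2
    have "v' = h'"
    proof (rule single)
      fix x
      show "(of_bool (x = v' + 1) - of_bool (x = v') :: int) = of_bool (x = h' + 1) - of_bool (x = h')"
        using assms[of x] unfolding 2 by linarith
    qed
    with 2 show ?thesis by simp
  next
    case 3
    \<comment> \<open>If \<open>h\<close> is neither \<open>v\<close> nor \<open>h'\<close>, the left side must not be positive at \<open>h + 1\<close>,
      which forces \<open>v' = h + 1\<close>; but then it is 1 at \<open>h + 2\<close>, where the same bound applies.\<close>
    have nonpos: "(of_bool (x = v + 1) - of_bool (x = v) + of_bool (x = h' + 1) - of_bool (x = h') :: int) \<le> 0"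
      if "x \<noteq> v + 1" "x \<noteq> h' + 1" for x
      using that by simp
    have "(of_bool (h + 1 = h + 1) - of_bool (h + 1 = h) + of_bool (h + 1 = v' + 1) - of_bool (h + 1 = v') :: int) \<le> 0"
      using nonpos[of "h + 1"] 3 unfolding assms by simp
    then have *: "v' = h + 1" by (cases "h + 1 = v'"; cases "h = v'"; simp)
    have "h + 1 \<noteq> v \<and> h + 1 \<noteq> h'"
      using assms[of "h + 1"] 3 unfolding * by (cases "h + 1 = v"; cases "h + 1 = h'") simp_all
    then have "(of_bool (h + 2 = h + 1) - of_bool (h + 2 = h) + of_bool (h + 2 = v' + 1) - of_bool (h + 2 = v') :: int) \<le> 0"
      using nonpos[of "h + 2"] unfolding assms by simp
    then have False unfolding * by simp
    then show ?thesis ..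
  qed
qed

text \<open>
An admissible array reduced to its particle numbers: \<open>M i j x\<close> counts the coordinates of
\<open>\<Lambda> i j\<close> equal to \<open>x\<close>. Forgetting the signatures makes two symmetries available by mere
renaming, the exchange of the two directions (\<open>transposed\<close>) and the half turn with negation of
positions (\<open>reversed\<close>).
\<close>

locale increment_grid =
  fixes m n :: int and h v :: "int \<Rightarrow> int \<Rightarrow> int" and M :: "int \<Rightarrow> int \<Rightarrow> int \<Rightarrow> nat"
  assumes m_nonneg: "0 \<le> m" and n_nonneg: "0 \<le> n"
    and hstep: "0 \<le> i \<Longrightarrow> i < m \<Longrightarrow> 0 \<le> j \<Longrightarrow> j \<le> n \<Longrightarrow>
      M (i + 1) j x + of_bool (x = h i j) = M i j x + of_bool (x = h i j + 1)"
    and vstep: "0 \<le> i \<Longrightarrow> i \<le> m \<Longrightarrow> 0 \<le> j \<Longrightarrow> j < n \<Longrightarrow>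
      M i (j + 1) x + of_bool (x = v i j) = M i j x + of_bool (x = v i j + 1)"
    and hmono: "0 \<le> i \<Longrightarrow> i + 1 < m \<Longrightarrow> 0 \<le> j \<Longrightarrow> j \<le> n \<Longrightarrow> h i j < h (i + 1) j"
    and vmono: "0 \<le> i \<Longrightarrow> i \<le> m \<Longrightarrow> 0 \<le> j \<Longrightarrow> j + 1 < n \<Longrightarrow> v i j < v i (j + 1)"
    and box: "0 \<le> i \<Longrightarrow> i < m \<Longrightarrow> 0 \<le> j \<Longrightarrow> j < n \<Longrightarrow> h i j = v i j \<Longrightarrow>
      h i (j + 1) = h i j \<or> h i (j + 1) = h i j + 1"
begin

definition zero where
  "zero i j \<longleftrightarrow> 0 \<le> i \<and> i < m \<and> 0 \<le> j \<and> j < n \<and> h i j = v i j \<and> h i (j + 1) = h i j"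

definition one where
  "one i j \<longleftrightarrow> 0 \<le> i \<and> i < m \<and> 0 \<le> j \<and> j < n \<and> h i j = v i j \<and> h i (j + 1) = h i j + 1"

text \<open>
For two non-trivial boxes that touch in a corner: the later one acts one position above the place
where the earlier one leaves its edges, that is \<open>r = rbar + 1\<close>.
\<close>

definition link where
  "link i j \<longleftrightarrow> h (i + 1) (j + 1) = h i (j + 1) + 1"

text \<open>
An edge of the box \<open>(i, j)\<close> is hit if the neighbouring edge on the same line, beyond the corner
of the box, sits at the adjacent position. Left and low hits concern the south-west corner and
enter the weights of \<open>U\<close>; right and top hits concern the north-east corner and take over their
role in the turned array.
\<close>

definition lefthit where "lefthit i j \<longleftrightarrow> 0 < i \<and> h i j = h (i - 1) j + 1"
definition lowhit where "lowhit i j \<longleftrightarrow> 0 < j \<and> v i j = v i (j - 1) + 1"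
definition righthit where "righthit i j \<longleftrightarrow> i + 1 < m \<and> h (i + 1) (j + 1) = h i (j + 1) + 1"
definition tophit where "tophit i j \<longleftrightarrow> j + 1 < n \<and> v (i + 1) (j + 1) = v (i + 1) j + 1"

lemma box_alternatives:
  assumes "0 \<le> i" "i < m" "0 \<le> j" "j < n"
  shows "h i (j + 1) = h i j \<and> v (i + 1) j = v i j \<or> h i j = v i j \<and> h i (j + 1) = v (i + 1) j"
proof -
  have "h i j = h i (j + 1) \<and> v i j = v (i + 1) j \<or> h i j = v i j \<and> h i (j + 1) = v (i + 1) j"
  proof (rule commuting_moves)
    fix x
    show "(of_bool (x = h i j + 1) - of_bool (x = h i j) + of_bool (x = v (i + 1) j + 1) - of_bool (x = v (i + 1) j) :: int)
     = of_bool (x = v i j + 1) - of_bool (x = v i j) + of_bool (x = h i (j + 1) + 1) - of_bool (x = h i (j + 1))"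
      using hstep[of i j x, THEN arg_cong[where f = int]]
        hstep[of i "j + 1" x, THEN arg_cong[where f = int]]
        vstep[of i j x, THEN arg_cong[where f = int]]
        vstep[of "i + 1" j x, THEN arg_cong[where f = int]] assms
      unfolding of_nat_add of_nat_of_bool by linarith
  qed
  then show ?thesis by auto
qed

lemma box_trichotomy:
  assumes "0 \<le> i" "i < m" "0 \<le> j" "j < n"
  obtains (trivial) "h i j \<noteq> v i j" "h i (j + 1) = h i j" "v (i + 1) j = v i j" "\<not> zero i j" "\<not> one i j"
    | (zero) "zero i j" "\<not> one i j" "v i j = h i j" "h i (j + 1) = h i j" "v (i + 1) j = h i j"
    | (one) "one i j" "\<not> zero i j" "v i j = h i j" "h i (j + 1) = h i j + 1" "v (i + 1) j = h i j + 1"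
proof (cases "h i j = v i j")
  case True
  then have eq: "h i (j + 1) = v (i + 1) j" using box_alternatives[OF assms] by auto
  from box[OF assms True] show ?thesis
  proof
    assume "h i (j + 1) = h i j"
    then show ?thesis using True eq assms by (intro zero) (simp_all add: zero_def one_def)
  next
    assume "h i (j + 1) = h i j + 1"
    then show ?thesis using True eq assms by (intro one) (simp_all add: zero_def one_def)
  qed
next
  case False
  then show ?thesis
    using box_alternatives[OF assms] by (intro trivial) (simp_all add: zero_def one_def)
qed

lemma zeroD:
  assumes "zero i j"
  shows "0 \<le> i" "i < m" "0 \<le> j" "j < n" "\<not> one i j"
    "v i j = h i j" "h i (j + 1) = h i j" "v (i + 1) j = h i j"
proof -
  show r: "0 \<le> i" "i < m" "0 \<le> j" "j < n" using assms by (simp_all add: zero_def)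
  show "\<not> one i j" "v i j = h i j" "h i (j + 1) = h i j" "v (i + 1) j = h i j"
    by (cases rule: box_trichotomy[OF r], use assms in simp_all)+
qed

lemma oneD:
  assumes "one i j"
  shows "0 \<le> i" "i < m" "0 \<le> j" "j < n" "\<not> zero i j"
    "v i j = h i j" "h i (j + 1) = h i j + 1" "v (i + 1) j = h i j + 1"
proof -
  show r: "0 \<le> i" "i < m" "0 \<le> j" "j < n" using assms by (simp_all add: one_def)
  show "\<not> zero i j" "v i j = h i j" "h i (j + 1) = h i j + 1" "v (i + 1) j = h i j + 1"
    by (cases rule: box_trichotomy[OF r], use assms in simp_all)+
qed

lemma count_after_h:
  assumes "0 \<le> i" "i < m" "0 \<le> j" "j \<le> n"
  shows "M (i + 1) j (h i j + 1) = Suc (M i j (h i j + 1))"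
    and "M i j (h i j) = Suc (M (i + 1) j (h i j))"
    and "x \<noteq> h i j \<Longrightarrow> x \<noteq> h i j + 1 \<Longrightarrow> M (i + 1) j x = M i j x"
  using hstep[OF assms, of "h i j + 1"] hstep[OF assms, of "h i j"] hstep[OF assms, of x] by simp_all

lemma count_after_v:
  assumes "0 \<le> i" "i \<le> m" "0 \<le> j" "j < n"
  shows "M i (j + 1) (v i j + 1) = Suc (M i j (v i j + 1))"
    and "M i j (v i j) = Suc (M i (j + 1) (v i j))"
    and "x \<noteq> v i j \<Longrightarrow> x \<noteq> v i j + 1 \<Longrightarrow> M i (j + 1) x = M i j x"
  using vstep[OF assms, of "v i j + 1"] vstep[OF assms, of "v i j"] vstep[OF assms, of x] by simp_all

lemma count_after_zero:
  assumes "zero i j"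
  shows "M (i + 1) j (h i j + 1) = Suc (M i j (h i j + 1))"
    and "M (i + 1) (j + 1) (h i j + 1) = Suc (M (i + 1) j (h i j + 1))"
    and "M i j (h i j) = Suc (M (i + 1) j (h i j))"
    and "M (i + 1) j (h i j) = Suc (M (i + 1) (j + 1) (h i j))"
proof -
  note r = zeroD(1-4)[OF assms]
  show "M (i + 1) j (h i j + 1) = Suc (M i j (h i j + 1))"
    by (rule count_after_h(1)) (use r in simp_all)
  show "M (i + 1) (j + 1) (h i j + 1) = Suc (M (i + 1) j (h i j + 1))"
    using count_after_v(1)[of "i + 1" j] r zeroD(8)[OF assms] by simp
  show "M i j (h i j) = Suc (M (i + 1) j (h i j))"
    by (rule count_after_h(2)) (use r in simp_all)
  show "M (i + 1) j (h i j) = Suc (M (i + 1) (j + 1) (h i j))"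
    using count_after_v(2)[of "i + 1" j] r zeroD(8)[OF assms] by simp
qed

lemma transposed: "increment_grid n m (\<lambda>i j. v j i) (\<lambda>i j. h j i) (\<lambda>i j. M j i)"
proof
  fix i j
  assume r: "0 \<le> i" "i < n" "0 \<le> j" "j < m" and "v j i = h j i"
  then show "v (j + 1) i = v j i \<or> v (j + 1) i = v j i + 1"
    by (cases rule: box_trichotomy[OF r(3,4,1,2)]) simp_all
qed (use m_nonneg n_nonneg hstep vstep hmono vmono in auto)

lemma reversed:
  "increment_grid m n (\<lambda>i j. - 1 - h (m - 1 - i) (n - j)) (\<lambda>i j. - 1 - v (m - i) (n - 1 - j))
    (\<lambda>i j x. M (m - i) (n - j) (- x))"
proof
  fix i j x
  show "M (m - (i + 1)) (n - j) (- x) + of_bool (x = - 1 - h (m - 1 - i) (n - j)) =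
      M (m - i) (n - j) (- x) + of_bool (x = - 1 - h (m - 1 - i) (n - j) + 1)"
    if "0 \<le> i" "i < m" "0 \<le> j" "j \<le> n"
  proof -
    have *: "(x = - 1 - h (m - 1 - i) (n - j)) = (- x = h (m - 1 - i) (n - j) + 1)"
      "(x = - 1 - h (m - 1 - i) (n - j) + 1) = (- x = h (m - 1 - i) (n - j))"
      "m - (i + 1) = m - 1 - i" "m - 1 - i + 1 = m - i" by auto
    then show ?thesis using hstep[of "m - 1 - i" "n - j" "- x"] that unfolding * by simp
  qed
  show "M (m - i) (n - (j + 1)) (- x) + of_bool (x = - 1 - v (m - i) (n - 1 - j)) =
      M (m - i) (n - j) (- x) + of_bool (x = - 1 - v (m - i) (n - 1 - j) + 1)"
    if "0 \<le> i" "i \<le> m" "0 \<le> j" "j < n"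
  proof -
    have *: "(x = - 1 - v (m - i) (n - 1 - j)) = (- x = v (m - i) (n - 1 - j) + 1)"
      "(x = - 1 - v (m - i) (n - 1 - j) + 1) = (- x = v (m - i) (n - 1 - j))"
      "n - (j + 1) = n - 1 - j" "n - 1 - j + 1 = n - j" by auto
    then show ?thesis using vstep[of "m - i" "n - 1 - j" "- x"] that unfolding * by simp
  qed
next
  fix i j
  show "- 1 - h (m - 1 - i) (n - j) < - 1 - h (m - 1 - (i + 1)) (n - j)"
    if "0 \<le> i" "i + 1 < m" "0 \<le> j" "j \<le> n"
    using hmono[of "m - 1 - (i + 1)" "n - j"] that by (simp add: algebra_simps)
  show "- 1 - v (m - i) (n - 1 - j) < - 1 - v (m - i) (n - 1 - (j + 1))"
    if "0 \<le> i" "i \<le> m" "0 \<le> j" "j + 1 < n"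
    using vmono[of "m - i" "n - 1 - (j + 1)"] that by (simp add: algebra_simps)
  assume r: "0 \<le> i" "i < m" "0 \<le> j" "j < n"
    and eq: "- 1 - h (m - 1 - i) (n - j) = - 1 - v (m - i) (n - 1 - j)"
  have "0 \<le> m - 1 - i" "m - 1 - i < m" "0 \<le> n - 1 - j" "n - 1 - j < n" using r by auto
  then show "- 1 - h (m - 1 - i) (n - (j + 1)) = - 1 - h (m - 1 - i) (n - j) \<or>
      - 1 - h (m - 1 - i) (n - (j + 1)) = - 1 - h (m - 1 - i) (n - j) + 1"
  proof (cases rule: box_trichotomy)
    case trivial
    then show ?thesis using eq by (simp add: algebra_simps)
  next
    case zero
    then show ?thesis by (simp add: algebra_simps)
  next
    case one
    then show ?thesis by (simp add: algebra_simps)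
  qed
qed (use m_nonneg n_nonneg in auto)

lemma row_increasing:
  assumes "0 \<le> i" "i < i'" "i' < m" "0 \<le> j" "j \<le> n"
  shows "h i j < h i' j"
proof -
  have "i + 1 \<le> i'" using assms by simp
  then have "i' < m \<longrightarrow> h i j < h i' j"
  proof (induction i' rule: int_ge_induct)
    case base
    then show ?case using hmono[of i j] assms by simp
  next
    case (step k)
    then show ?case using hmono[of k j] assms by auto
  qed
  then show ?thesis using assms by simp
qed

text \<open>
The moves of a row have distinct positions, so the particle number at \<open>x\<close> changes only by the
possible move from \<open>x - 1\<close> and the possible move from \<open>x\<close>.
\<close>

lemma row_count:
  assumes "0 \<le> k" "k \<le> m" "0 \<le> j" "j \<le> n"
  shows "M k j x + of_bool (x \<in> (\<lambda>i. h i j) ` {0..<k}) = M 0 j x + of_bool (x - 1 \<in> (\<lambda>i. h i j) ` {0..<k})"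
  using assms(1,2)
proof (induction k rule: int_ge_induct)
  case base
  then show ?case by simp
next
  case (step k)
  have ins: "{0..<k + 1} = insert k {0..<k}" using step by auto
  have new: "h k j \<notin> (\<lambda>i. h i j) ` {0..<k}"
    using row_increasing[of _ k j] step assms by force
  have "x - 1 = h k j \<longleftrightarrow> x = h k j + 1" by auto
  moreover have "of_bool (x \<in> (\<lambda>i. h i j) ` {0..<k + 1}) =
      of_bool (x \<in> (\<lambda>i. h i j) ` {0..<k}) + (of_bool (x = h k j) :: nat)"
    "of_bool (x - 1 \<in> (\<lambda>i. h i j) ` {0..<k + 1}) =
      of_bool (x - 1 \<in> (\<lambda>i. h i j) ` {0..<k}) + (of_bool (x - 1 = h k j) :: nat)"
    unfolding ins image_insert using new by auto
  moreover have "M (k + 1) j x + of_bool (x = h k j) = M k j x + of_bool (x = h k j + 1)"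
    using hstep[of k j x] step assms by simp
  ultimately show ?case using step by simp
qed

lemma col_increasing:
  assumes "0 \<le> j" "j < j'" "j' < n" "0 \<le> i" "i \<le> m"
  shows "v i j < v i j'"
proof -
  interpret tr: increment_grid n m "\<lambda>i j. v j i" "\<lambda>i j. h j i" "\<lambda>i j. M j i" by (rule transposed)
  show ?thesis using tr.row_increasing assms by simp
qed

lemma col_count:
  assumes "0 \<le> k" "k \<le> n" "0 \<le> i" "i \<le> m"
  shows "M i k x + of_bool (x \<in> v i ` {0..<k}) = M i 0 x + of_bool (x - 1 \<in> v i ` {0..<k})"
proof -
  interpret tr: increment_grid n m "\<lambda>i j. v j i" "\<lambda>i j. h j i" "\<lambda>i j. M j i" by (rule transposed)
  show ?thesis using tr.row_count[OF assms] by simp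
qed

lemma column_step:
  assumes "0 \<le> i" "i < m" "0 \<le> j" "j < n"
  shows "h i j \<le> h i (j + 1)"
  using assms by (cases rule: box_trichotomy) simp_all

lemma column_nondecreasing:
  assumes "0 \<le> i" "i < m" "0 \<le> j" "j \<le> j'" "j' \<le> n"
  shows "h i j \<le> h i j'"
  using assms(4,5)
proof (induction j' rule: int_ge_induct)
  case (step k)
  then show ?case using column_step[of i k] assms by simp
qed simp

text \<open>
After a zero-box at position \<open>k\<close>, the vertical moves further up are all from positions above \<open>k\<close>,
so they never meet the horizontal move again.
\<close>

lemma column_constant_after_zero:
  assumes "zero i j" "j < j'" "j' \<le> n"
  shows "h i j' = h i j"
proof -
  note r = zeroD[OF assms(1)]
  have "j + 1 \<le> j'" using assms by simp
  then have "j' \<le> n \<longrightarrow> h i j' = h i j"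
  proof (induction j' rule: int_ge_induct)
    case base
    then show ?case using r by simp
  next
    case (step k)
    show ?case
    proof
      assume k: "k + 1 \<le> n"
      have "v i j < v i k" using col_increasing[of j k i] r step k by simp
      moreover have "h i k = h i j" using step k by simp
      ultimately have "h i k \<noteq> v i k" using r by simp
      moreover have "h i (k + 1) = h i k \<or> h i k = v i k"
        using box_alternatives[of i k] r step k by auto
      ultimately show "h i (k + 1) = h i j" using \<open>h i k = h i j\<close> by simp
    qed
  qed
  then show ?thesis using assms by simp
qed

end

section \<open>Uniqueness of the grid\<close>

lemma increasing_int_unique:
  fixes p p' :: "int \<Rightarrow> int"
  assumes "\<And>i i'. 0 \<le> i \<Longrightarrow> i < i' \<Longrightarrow> i' < m \<Longrightarrow> p i < p i'"
    and "\<And>i i'. 0 \<le> i \<Longrightarrow> i < i' \<Longrightarrow> i' < m \<Longrightarrow> p' i < p' i'"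
    and "p ` {0..<m} = p' ` {0..<m}"
    and "0 \<le> i" "i < m"
  shows "p i = p' i"
proof -
  have sorted: "sorted_wrt (<) (map f [0..m - 1])"
    if "\<And>i i'. 0 \<le> i \<Longrightarrow> i < i' \<Longrightarrow> i' < m \<Longrightarrow> f i < f i'" for f :: "int \<Rightarrow> int"
    unfolding sorted_wrt_map
    by (rule sorted_wrt_mono_rel[OF _ sorted_wrt_upto]) (use that in auto)
  have "{0..<m} = {0..m - 1}" by auto
  then have "set (map p' [0..m - 1]) = set (map p [0..m - 1])" using assms(3) by simp
  then have "map p' [0..m - 1] = map p [0..m - 1]"
    using sorted[of p] sorted[of p'] assms(1,2) by (intro strict_sorted_equal) simp_all
  then show ?thesis using assms(4,5) by simp
qed

text \<open>
At the largest element \<open>z\<close> of the symmetric difference, the two sides for \<open>x = z + 1\<close> cannot agree.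
\<close>

lemma finite_set_from_differences:
  fixes A B :: "int set"
  assumes "finite A" "finite B"
    and diff: "\<And>x. (of_bool (x - 1 \<in> A) - of_bool (x \<in> A) :: int) = of_bool (x - 1 \<in> B) - of_bool (x \<in> B)"
  shows "A = B"
proof (rule ccontr)
  let ?D = "(A - B) \<union> (B - A)"
  assume "A \<noteq> B"
  then have "?D \<noteq> {}" "finite ?D" using assms by auto
  then obtain z where z: "z \<in> ?D" "z + 1 \<notin> ?D"
    using Max_in[of ?D] Max_ge[of ?D "Max ?D + 1"] by fastforce
  then have "z + 1 \<in> A \<longleftrightarrow> z + 1 \<in> B" by blast
  then have "z \<in> A \<longleftrightarrow> z \<in> B" using diff[of "z + 1"] by (cases "z \<in> A"; cases "z \<in> B"; simp)
  then show False using z by blast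
qed

text \<open>
The ends of a row fix the set of positions by \<open>row_count\<close>, and increasing order fixes
its enumeration.
\<close>

lemma row_determined:
  assumes g: "increment_grid m n h v M" "increment_grid m n h' v' M'"
    and ends: "M 0 j = M' 0 j" "M m j = M' m j"
    and j: "0 \<le> j" "j \<le> n" and i: "0 \<le> i" "i < m"
  shows "h i j = h' i j"
proof -
  interpret A: increment_grid m n h v M by (rule g(1))
  interpret B: increment_grid m n h' v' M' by (rule g(2))
  have "(\<lambda>i. h i j) ` {0..<m} = (\<lambda>i. h' i j) ` {0..<m}"
  proof (rule finite_set_from_differences)
    fix x
    show "(of_bool (x - 1 \<in> (\<lambda>i. h i j) ` {0..<m}) - of_bool (x \<in> (\<lambda>i. h i j) ` {0..<m}) :: int) =
      of_bool (x - 1 \<in> (\<lambda>i. h' i j) ` {0..<m}) - of_bool (x \<in> (\<lambda>i. h' i j) ` {0..<m})"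
      using A.row_count[OF A.m_nonneg order_refl j, of x, THEN arg_cong[where f = int]]
        B.row_count[OF A.m_nonneg order_refl j, of x, THEN arg_cong[where f = int]]
      unfolding ends of_nat_add of_nat_of_bool by linarith
  qed simp_all
  then show ?thesis
    using increasing_int_unique[of m "\<lambda>i. h i j" "\<lambda>i. h' i j" i] A.row_increasing B.row_increasing i j
    by auto
qed

text \<open>
The corners determine the four sides. Inside a column, the only freedom is the choice between a
zero-box and a one-box; a zero-box freezes the horizontal position for the rest of the column,
whereas a one-box raises it for good. So the position at the top of the column reveals the choice, and
the vertical positions propagate from one column to the next.
\<close>

lemma grid_determined:
  assumes g: "increment_grid m n h v M" "increment_grid m n h' v' M'"
    and corners: "M 0 0 = M' 0 0" "M m 0 = M' m 0" "M 0 n = M' 0 n" "M m n = M' m n"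
  shows "\<And>i j. 0 \<le> i \<Longrightarrow> i < m \<Longrightarrow> 0 \<le> j \<Longrightarrow> j \<le> n \<Longrightarrow> h i j = h' i j"
    and "\<And>i j. 0 \<le> i \<Longrightarrow> i \<le> m \<Longrightarrow> 0 \<le> j \<Longrightarrow> j < n \<Longrightarrow> v i j = v' i j"
    and "\<And>i j. 0 \<le> i \<Longrightarrow> i \<le> m \<Longrightarrow> 0 \<le> j \<Longrightarrow> j \<le> n \<Longrightarrow> M i j = M' i j"
proof -
  interpret A: increment_grid m n h v M by (rule g(1))
  interpret B: increment_grid m n h' v' M' by (rule g(2))
  have bottom: "h i 0 = h' i 0" and top: "h i n = h' i n" if "0 \<le> i" "i < m" for i
    using row_determined[OF g, of 0 i] row_determined[OF g, of n i] corners that A.n_nonneg by simp_all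
  have left: "v 0 j = v' 0 j" if "0 \<le> j" "j < n" for j
    using row_determined[OF A.transposed B.transposed, of 0 j] corners that A.m_nonneg by simp
  have column: "h i j = h' i j" if i: "0 \<le> i" "i < m" and v: "\<And>j. 0 \<le> j \<Longrightarrow> j < n \<Longrightarrow> v i j = v' i j"
    and j: "0 \<le> j" "j \<le> n" for i j
  proof -
    have "j \<le> n \<longrightarrow> h i j = h' i j" using j(1)
    proof (induction j rule: int_ge_induct)
      case base
      then show ?case using bottom i by simp
    next
      case (step j)
      show ?case
      proof
        assume "j + 1 \<le> n"
        then have r: "0 \<le> i" "i < m" "0 \<le> j" "j < n" and h: "h i j = h' i j" and v: "v i j = v' i j"
          using step i v by simp_all
        \<comment> \<open>A zero-box here leaves the position of the column at \<open>h i j\<close> up to the top, a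
          one-box does not.\<close>
        have no: False if "A.zero i j" "B.one i j"
          using A.column_constant_after_zero[OF that(1), of n] B.column_nondecreasing[of i "j + 1" n]
            B.oneD(7)[OF that(2)] h r top[of i] by simp
        have no': False if "B.zero i j" "A.one i j"
          using B.column_constant_after_zero[OF that(1), of n] A.column_nondecreasing[of i "j + 1" n]
            A.oneD(7)[OF that(2)] h r top[of i] by simp
        show "h i (j + 1) = h' i (j + 1)"
          using r
        proof (cases rule: A.box_trichotomy)
          case trivial
          with B.box_alternatives[OF r] h v show ?thesis by auto
        next
          case zero
          with B.box[OF r] no h v r show ?thesis unfolding B.one_def by auto
        next
          case one
          with B.box[OF r] no' h v r show ?thesis unfolding B.zero_def by auto
        qed
      qed
    qed
    then show ?thesis using j by simp
  qed
  have vert: "\<forall>j. 0 \<le> j \<and> j < n \<longrightarrow> v i j = v' i j" if "0 \<le> i" "i \<le> m" for i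
    using that
  proof (induction i rule: int_ge_induct)
    case base
    then show ?case using left by simp
  next
    case (step i)
    show ?case
    proof (intro allI impI)
      fix j assume j: "0 \<le> j \<and> j < n"
      have v: "\<And>j. 0 \<le> j \<Longrightarrow> j < n \<Longrightarrow> v i j = v' i j" using step by simp
      have "h i j = h' i j" "h i (j + 1) = h' i (j + 1)" "v i j = v' i j"
        using column[of i, OF _ _ v] step j v by simp_all
      then show "v (i + 1) j = v' (i + 1) j"
        using A.box_alternatives[of i j] B.box_alternatives[of i j] step j by auto
    qed
  qed
  then show v: "v i j = v' i j" if "0 \<le> i" "i \<le> m" "0 \<le> j" "j < n" for i j using that by simp
  show h: "h i j = h' i j" if "0 \<le> i" "i < m" "0 \<le> j" "j \<le> n" for i j
    using column[of i j] v that by simp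
  show "M i j = M' i j" if r: "0 \<le> i" "i \<le> m" "0 \<le> j" "j \<le> n" for i j
  proof
    fix x
    have "(\<lambda>i. h i j) ` {0..<i} = (\<lambda>i. h' i j) ` {0..<i}" using h r by (intro image_cong) auto
    moreover have "v 0 ` {0..<j} = v' 0 ` {0..<j}" using v r by (intro image_cong) auto
    ultimately show "M i j x = M' i j x"
      using A.row_count[OF r, of x] B.row_count[OF r, of x] A.col_count[OF r(3,4), of 0 x]
        B.col_count[OF r(3,4), of 0 x] corners(1) A.m_nonneg by simp
  qed
qed

section \<open>Exchange relations for boxes and edges\<close>

definition qnum :: "real \<Rightarrow> nat \<Rightarrow> real" where
  "qnum t k = 1 - t ^ k"

lemma qnum_nonzero: "0 \<le> t \<Longrightarrow> t < 1 \<Longrightarrow> 0 < k \<Longrightarrow> qnum t k \<noteq> 0"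
  unfolding qnum_def using power_less_one_iff[of t k] by simp

locale weighted_grid = increment_grid +
  fixes t :: real
  assumes t_nonneg: "0 \<le> t" and t_less_1: "t < 1"
begin

text \<open>
The part of the weight of a non-trivial box that depends on the number of particles at the
position \<open>r\<close>, without the powers of \<open>t\<close> and \<open>1 - t\<close>. The outgoing version is the same expression
for the turned array: its count is taken at the north-east corner, at the position \<open>rbar + 1\<close>.
\<close>

definition in_factor where
  "in_factor i j = (let c = M i j (h i j) in
     if zero i j then qnum t (c - 1) / qnum t c else if one i j then 1 / qnum t c else 1)"

definition out_factor where
  "out_factor i j = (let c = M (i + 1) (j + 1) (h i (j + 1) + 1) in
     if zero i j then qnum t (c - 1) / qnum t c else if one i j then 1 / qnum t c else 1)"

lemma qnum_count_nonzero: "0 < k \<Longrightarrow> qnum t k \<noteq> 0"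
  using qnum_nonzero t_nonneg t_less_1 by blast

lemma qnum_count_h:
  assumes "0 \<le> i" "i < m" "0 \<le> j" "j \<le> n"
  shows "qnum t (M (i + 1) j (h i j + 1)) \<noteq> 0" "qnum t (M i j (h i j)) \<noteq> 0"
  using qnum_count_nonzero count_after_h[OF assms] by simp_all

lemma qnum_count_v:
  assumes "0 \<le> i" "i \<le> m" "0 \<le> j" "j < n"
  shows "qnum t (M i (j + 1) (v i j + 1)) \<noteq> 0" "qnum t (M i j (v i j)) \<noteq> 0"
  using qnum_count_nonzero count_after_v[OF assms] by simp_all

lemma in_factor_nonzero: "in_factor i j \<noteq> 0"
proof -
  consider "zero i j" | "one i j" | "\<not> zero i j" "\<not> one i j" by blast
  then show ?thesis
  proof cases
    case 1
    then show ?thesis using count_after_zero[OF 1] qnum_count_nonzero by (simp add: in_factor_def)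
  next
    case 2
    then show ?thesis using oneD[OF 2] qnum_count_h(2)[of i j] by (simp add: in_factor_def)
  qed (simp add: in_factor_def)
qed

lemma out_factor_nonzero: "out_factor i j \<noteq> 0"
proof -
  consider "zero i j" | "one i j" | "\<not> zero i j" "\<not> one i j" by blast
  then show ?thesis
  proof cases
    case 1
    then show ?thesis using count_after_zero[OF 1] zeroD(7)[OF 1] qnum_count_nonzero by (simp add: out_factor_def)
  next
    case 2
    then show ?thesis using oneD[OF 2] qnum_count_h(1)[of i "j + 1"] by (simp add: out_factor_def)
  qed (simp add: out_factor_def)
qed

text \<open>
A horizontal edge carries \<open>qnum\<close> of the number of particles at its target after the move, and a
vertical edge \<open>qnum\<close> of the number at its source before the move. Passing from the bottom and left edge of a box to its
top and right edge changes the product of these factors exactly by \<open>in_factor\<close> against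
\<open>out_factor\<close>. In a trivial box the edges see each other only if the vertical move starts where the
horizontal one ends, and then the two changes cancel.
\<close>

lemma box_exchange:
  assumes r: "0 \<le> i" "i < m" "0 \<le> j" "j < n"
  shows "qnum t (M (i + 1) j (h i j + 1)) * qnum t (M i j (v i j)) * in_factor i j =
    qnum t (M (i + 1) (j + 1) (h i (j + 1) + 1)) * qnum t (M (i + 1) j (v (i + 1) j)) * out_factor i j"
using r
  proof (cases rule: box_trichotomy)
  case trivial
  have G: "in_factor i j = 1" "out_factor i j = 1" using trivial by (simp_all add: in_factor_def out_factor_def)
  show ?thesis
  proof (cases "v i j = h i j + 1")
    case True
    have "M (i + 1) j (h i j + 1) = Suc (M (i + 1) (j + 1) (h i j + 1))"
      using count_after_v(2)[of "i + 1" j] r True trivial by simp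
    moreover have "M (i + 1) j (h i j + 1) = Suc (M i j (h i j + 1))"
      by (rule count_after_h(1)) (use r in simp_all)
    ultimately show ?thesis using True trivial G by simp
  next
    case False
    have "M (i + 1) (j + 1) (h i j + 1) = M (i + 1) j (h i j + 1)"
      using count_after_v(3)[of "i + 1" j "h i j + 1"] r False trivial by simp
    moreover have "M (i + 1) j (v i j) = M i j (v i j)"
      using count_after_h(3)[of i j "v i j"] r False trivial by simp
    ultimately show ?thesis using trivial G by simp
  qed
next
  case zero
  note c = count_after_zero[OF zero(1)]
  have "qnum t (M i j (h i j)) \<noteq> 0" "qnum t (M (i + 1) (j + 1) (h i j + 1)) \<noteq> 0"
    using c qnum_count_nonzero by simp_all
  moreover have "M i j (h i j) - 1 = M (i + 1) j (h i j)"
    "M (i + 1) (j + 1) (h i j + 1) - 1 = M (i + 1) j (h i j + 1)"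
    using c(2,3) by simp_all
  ultimately show ?thesis using zero by (simp add: in_factor_def out_factor_def Let_def)
next
  case one
  have "qnum t (M i j (h i j)) \<noteq> 0" using qnum_count_h(2)[of i j] r by simp
  moreover have "qnum t (M (i + 1) (j + 1) (h i j + 1 + 1)) \<noteq> 0"
    using qnum_count_v(1)[of "i + 1" j] r one by simp
  ultimately show ?thesis using one by (simp add: in_factor_def out_factor_def Let_def)
qed

text \<open>
The factor that compensates, at a grid point, two consecutive edges of a line at adjacent positions:
the coefficients \<open>\<phi>\<close> and \<open>\<psi>\<close> contain no factor for the position where one edge ends and the next begins.
\<close>

definition left_corner where
  "left_corner i j = (if lefthit i j then qnum t (M i j (h i j)) else 1)"

definition low_corner where
  "low_corner i j = (if lowhit i j then qnum t (M i j (v i j)) else 1)"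

text \<open>
Follow a pair of horizontal edges at adjacent positions upwards across the vertical edge between
them. The pair changes its factor, dissolves or arises only if that vertical edge meets an edge
of the pair, and then the change is the factor of the non-trivial box formed with the right edge (a
left hit of that box) or with the left edge (a right hit of that box).
\<close>

lemma adjacent_exchange:
  assumes i: "0 \<le> i" "i < m" and j: "0 \<le> j" "j < n"
  shows "left_corner i j * (if lefthit i j then in_factor i j else 1) =
    left_corner i (j + 1) * (if righthit (i - 1) j then out_factor (i - 1) j else 1)"
proof (cases "0 < i")
  case False
  have "out_factor (-1) j = 1" by (simp add: out_factor_def zero_def one_def)
  then show ?thesis using False i by (simp add: left_corner_def lefthit_def)
next
  case True
  define a b w where "a = h (i - 1) j" and "b = h i j" and "w = v i j"
  define c d where "c = M i j b" and "d = M i (j + 1) (h i (j + 1))"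
  have il: "0 \<le> i - 1" "i - 1 < m" and ii: "i - 1 + 1 = i" using True i by auto
  have ab: "a < b" and ab': "h (i - 1) (j + 1) < h i (j + 1)"
    using hmono[of "i - 1" j] hmono[of "i - 1" "j + 1"] True i j by (simp_all add: a_def b_def)
  have hit: "lefthit i j \<longleftrightarrow> b = a + 1" "lefthit i (j + 1) \<longleftrightarrow> h i (j + 1) = h (i - 1) (j + 1) + 1"
    "righthit (i - 1) j \<longleftrightarrow> h i (j + 1) = h (i - 1) (j + 1) + 1"
    using True i by (auto simp: lefthit_def righthit_def a_def b_def)
  have q0: "qnum t c \<noteq> 0" "qnum t d \<noteq> 0"
    using qnum_count_h(2)[of i j] qnum_count_h(2)[of i "j + 1"] i j by (simp_all add: c_def d_def b_def)
  have P: "left_corner i j = (if b = a + 1 then qnum t c else 1)"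
    "left_corner i (j + 1) = (if h i (j + 1) = h (i - 1) (j + 1) + 1 then qnum t d else 1)"
    by (simp_all only: left_corner_def hit c_def d_def b_def)
  have GL: "in_factor i j = (if zero i j then qnum t (c - 1) / qnum t c else if one i j then 1 / qnum t c else 1)"
    by (simp add: in_factor_def c_def b_def Let_def)
  have GR: "out_factor (i - 1) j = (if zero (i - 1) j then qnum t (d - 1) / qnum t d else if one (i - 1) j then 1 / qnum t d else 1)"
    if "h i (j + 1) = h (i - 1) (j + 1) + 1"
    using that by (simp add: out_factor_def d_def Let_def)
  have cd: "d = c" if "h i (j + 1) = b" "b \<noteq> w" "b \<noteq> w + 1"
    unfolding d_def c_def that(1) using count_after_v(3)[of i j b] i j that by (simp add: w_def)
  have cd1: "c = Suc d" if "h i (j + 1) = b" "b = w"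
    unfolding d_def c_def that(1) using count_after_v(2)[of i j] i j that by (simp add: w_def)
  have cd2: "d = Suc c" if "h i (j + 1) = b" "b = w + 1"
    unfolding d_def c_def that(1) using count_after_v(1)[of i j] i j that by (simp add: w_def)
  show ?thesis
  using il j
  proof (cases rule: box_trichotomy)
    case L: trivial
    have L': "w \<noteq> a" "h (i - 1) (j + 1) = a" using L by (simp_all add: ii a_def w_def)
    show ?thesis
    using i j
  proof (cases rule: box_trichotomy)
      case trivial
      then have "b \<noteq> w" "h i (j + 1) = b" by (simp_all add: b_def w_def)
      then show ?thesis using L L' trivial cd unfolding P GL hit by (auto simp: GR)
    next
      case zero
      then have "b = w" "h i (j + 1) = b" by (simp_all add: b_def w_def)
      then show ?thesis using L L' zero cd1 q0 unfolding P GL hit by (auto simp: GR)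
    next
      case one
      then have "b = w" "h i (j + 1) = b + 1" by (simp_all add: b_def w_def)
      then show ?thesis using L L' one ab q0 unfolding P GL hit by (auto simp: GR)
    qed
  next
    case L: zero
    have L': "w = a" "h (i - 1) (j + 1) = a" using L by (simp_all add: ii a_def w_def)
    show ?thesis
    using i j
  proof (cases rule: box_trichotomy)
      case trivial
      then have "b \<noteq> w" "h i (j + 1) = b" by (simp_all add: b_def w_def)
      then show ?thesis using L L' trivial cd2 q0 unfolding P GL hit by (auto simp: GR)
    qed (use ab L' in \<open>simp_all add: b_def w_def\<close>)
  next
    case L: one
    have L': "w = a + 1" "h (i - 1) (j + 1) = a + 1" using L by (simp_all add: ii a_def w_def)
    show ?thesis
    using i j
  proof (cases rule: box_trichotomy)
      case trivial
      then have "b \<noteq> w" "h i (j + 1) = b" by (simp_all add: b_def w_def)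
      then show ?thesis using L L' trivial q0 unfolding P GL hit by (auto simp: GR)
    next
      case zero
      then show ?thesis using ab' L' by (simp add: b_def w_def)
    next
      case one
      then have "b = w" "h i (j + 1) = b + 1" by (simp_all add: b_def w_def)
      then show ?thesis using L L' one ab q0 unfolding P GL hit by (auto simp: GR)
    qed
  qed
qed

lemma transposed_weighted: "weighted_grid n m (\<lambda>i j. v j i) (\<lambda>i j. h j i) (\<lambda>i j. M j i) t"
  using transposed t_nonneg t_less_1
  by (simp add: weighted_grid_def weighted_grid_axioms_def)

lemma transposed_boxes:
  shows "increment_grid.zero n m (\<lambda>i j. v j i) (\<lambda>i j. h j i) j i \<longleftrightarrow> zero i j"
    and "increment_grid.one n m (\<lambda>i j. v j i) (\<lambda>i j. h j i) j i \<longleftrightarrow> one i j"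
proof -
  interpret tr: weighted_grid n m "\<lambda>i j. v j i" "\<lambda>i j. h j i" "\<lambda>i j. M j i" t
    by (rule transposed_weighted)
  show "tr.zero j i \<longleftrightarrow> zero i j"
    using zeroD[of i j] tr.zeroD[of j i] unfolding zero_def tr.zero_def by metis
  show "tr.one j i \<longleftrightarrow> one i j"
    using oneD[of i j] tr.oneD[of j i] unfolding one_def tr.one_def by metis
qed

lemma adjacent_exchange_v:
  assumes i: "0 \<le> i" "i < m" and j: "0 \<le> j" "j < n"
  shows "low_corner i j * (if lowhit i j then in_factor i j else 1) =
    low_corner (i + 1) j * (if tophit i (j - 1) then out_factor i (j - 1) else 1)"
proof -
  interpret tr: weighted_grid n m "\<lambda>i j. v j i" "\<lambda>i j. h j i" "\<lambda>i j. M j i" t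
    by (rule transposed_weighted)
  have in_factor: "tr.in_factor j i = in_factor i j"
    unfolding in_factor_def tr.in_factor_def transposed_boxes
    using zeroD(6)[of i j] oneD(6)[of i j] by (simp add: Let_def)
  have out_factor: "tr.out_factor j' i = out_factor i j'" for j'
    unfolding out_factor_def tr.out_factor_def transposed_boxes
    using zeroD(7,8)[of i j'] oneD(7,8)[of i j'] by (simp add: Let_def)
  show ?thesis
    using tr.adjacent_exchange[of j i] i j
    unfolding tr.left_corner_def low_corner_def in_factor out_factor tr.lefthit_def lowhit_def tr.righthit_def tophit_def
    by simp
qed

lemma one_left:
  assumes "one (i - 1) j" "zero i j \<or> one i j"
  shows "one i j" "h i j = h (i - 1) j + 1"
proof -
  note L = oneD[OF assms(1)]
  have r: "0 \<le> i" "i < m" "0 \<le> j" "j < n" using assms(2) zeroD(1-4) oneD(1-4) by blast+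
  have w: "v i j = h i j" using assms(2) zeroD(6) oneD(6) by blast
  then show "h i j = h (i - 1) j + 1" using L by simp
  have "h (i - 1) (j + 1) < h i (j + 1)" using hmono[of "i - 1" "j + 1"] L r by simp
  then have "\<not> zero i j" using L w zeroD(7)[of i j] by auto
  then show "one i j" using assms(2) by blast
qed

lemma zero_left:
  assumes "zero (i - 1) j"
  shows "\<not> zero i j" "\<not> one i j"
proof -
  have "v i j \<noteq> h i j" if "i < m"
    using zeroD[OF assms] hmono[of "i - 1" j] that by simp
  then show "\<not> zero i j" "\<not> one i j" unfolding zero_def one_def by auto
qed

lemma one_below:
  assumes "one i (j - 1)" "zero i j \<or> one i j"
  shows "one i j" "v i j = v i (j - 1) + 1"
proof -
  interpret tr: weighted_grid n m "\<lambda>i j. v j i" "\<lambda>i j. h j i" "\<lambda>i j. M j i" t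
    by (rule transposed_weighted)
  show "one i j" "v i j = v i (j - 1) + 1"
    using tr.one_left[of j i] assms transposed_boxes by simp_all
qed

lemma zero_below:
  assumes "zero i (j - 1)"
  shows "\<not> zero i j" "\<not> one i j"
proof -
  interpret tr: weighted_grid n m "\<lambda>i j. v j i" "\<lambda>i j. h j i" "\<lambda>i j. M j i" t
    by (rule transposed_weighted)
  show "\<not> zero i j" "\<not> one i j"
    using tr.zero_left[of j i] assms transposed_boxes by simp_all
qed

text \<open>
If both incoming edges of a non-trivial box sit at \<open>r - 1\<close>, then they are the outgoing edges of the
box diagonally before it. As these coincide, that box is non-trivial too.
\<close>

lemma both_hits_diagonal:
  assumes "lefthit i j" "lowhit i j" "zero i j \<or> one i j"
  shows "zero (i - 1) (j - 1) \<or> one (i - 1) (j - 1)" "link (i - 1) (j - 1)"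
proof -
  have r: "0 \<le> i" "i < m" "0 \<le> j" "j < n" using assms(3) zeroD(1-4) oneD(1-4) by blast+
  have w: "v i j = h i j" using assms(3) zeroD(6) oneD(6) by blast
  have e: "h (i - 1) (j - 1 + 1) = v (i - 1 + 1) (j - 1)" and p: "0 < i" "0 < j"
    using assms(1,2) w by (simp_all add: lefthit_def lowhit_def)
  have "0 \<le> i - 1" "i - 1 < m" "0 \<le> j - 1" "j - 1 < n" using r p by simp_all
  then show "zero (i - 1) (j - 1) \<or> one (i - 1) (j - 1)"
    by (cases rule: box_trichotomy) (use e in simp_all)
  show "link (i - 1) (j - 1)" using assms(1) by (simp add: link_def lefthit_def)
qed

lemma diagonal_hits:
  assumes "zero (i - 1) (j - 1) \<or> one (i - 1) (j - 1)" "zero i j \<or> one i j" "link (i - 1) (j - 1)"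
  shows "lefthit i j" "lowhit i j"
proof -
  have r: "0 \<le> i - 1" "0 \<le> j - 1" using assms(1) zeroD(1,3) oneD(1,3) by blast+
  have w: "v i j = h i j" using assms(2) zeroD(6) oneD(6) by blast
  have "h (i - 1) j = v i (j - 1)"
    using assms(1) zeroD(7,8)[of "i - 1" "j - 1"] oneD(7,8)[of "i - 1" "j - 1"] by auto
  with r w show "lefthit i j" "lowhit i j"
    using assms(3) by (simp_all add: lefthit_def lowhit_def link_def)
qed

definition zero_diag where "zero_diag i j \<longleftrightarrow> zero i j \<and> zero (i + 1) (j + 1) \<and> link i j"
definition one_diag where "one_diag i j \<longleftrightarrow> one i j \<and> one (i + 1) (j + 1) \<and> link i j"
definition mixed_diag where
  "mixed_diag i j \<longleftrightarrow> (zero i j \<and> one (i + 1) (j + 1) \<or> one i j \<and> zero (i + 1) (j + 1)) \<and> link i j"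

text \<open>
One-boxes on the left and below imply a diagonal one-box. This, together with its mirror image, is
what makes clusters of one-boxes have as many beginnings as ends.
\<close>

lemma one_left_and_below:
  assumes "one (i - 1) j" "one i (j - 1)" "one i j"
  shows "one_diag (i - 1) (j - 1)"
proof -
  have hits: "lefthit i j" "lowhit i j"
    using one_left(2)[of i j] one_below(2)[of i j] assms oneD(1)[OF assms(1)] oneD(3)[OF assms(2)]
    by (simp_all add: lefthit_def lowhit_def)
  have "\<not> zero (i - 1) (j - 1)" using zero_below[of "i - 1" j] assms by auto
  then show ?thesis using both_hits_diagonal[OF hits] assms by (auto simp: one_diag_def)
qed

lemma one_right_and_above:
  assumes "one (i + 1) j" "one i (j + 1)" "one i j"
  shows "one_diag i j"
proof -
  have w: "h i (j + 1) = v (i + 1) j" using oneD[OF assms(3)] by simp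
  have r: "0 \<le> i + 1" "i + 1 < m" "0 \<le> j + 1" "j + 1 < n"
    using oneD(1-4)[OF assms(1)] oneD(1-4)[OF assms(2)] by simp_all
  have e: "h (i + 1) (j + 1) = h (i + 1) j + 1" "v (i + 1) (j + 1) = h i (j + 1) + 1"
    "v (i + 1) j = h (i + 1) j" using oneD[OF assms(1)] oneD[OF assms(2)] by simp_all
  have "zero (i + 1) (j + 1) \<or> one (i + 1) (j + 1)"
    using r by (cases rule: box_trichotomy) (use e w in simp_all)
  then have "one (i + 1) (j + 1)" using one_below(1)[of "i + 1" "j + 1"] assms by simp
  then show ?thesis using assms e w by (simp add: one_diag_def link_def)
qed

text \<open>
A box hit from the left and from below continues its diagonal predecessor, and both factors
are then read at the same grid point and the same position.
\<close>

lemma diagonal_exchange: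
  assumes "\<not> mixed_diag (i - 1) (j - 1)" and r: "0 \<le> i" "i < m" "0 \<le> j" "j < n"
  shows "(if lefthit i j \<and> lowhit i j then in_factor i j else 1) =
    (if righthit (i - 1) (j - 1) \<and> tophit (i - 1) (j - 1) then out_factor (i - 1) (j - 1) else 1)"
proof (cases "0 < i \<and> 0 < j")
  case False
  then have "\<not> (zero (i - 1) (j - 1) \<or> one (i - 1) (j - 1))"
    using zeroD(1,3)[of "i - 1" "j - 1"] oneD(1,3)[of "i - 1" "j - 1"] by auto
  then have "out_factor (i - 1) (j - 1) = 1" by (simp add: out_factor_def)
  then show ?thesis using False by (auto simp: lefthit_def lowhit_def)
next
  case True
  have hits: "righthit (i - 1) (j - 1) \<longleftrightarrow> lefthit i j" "tophit (i - 1) (j - 1) \<longleftrightarrow> lowhit i j"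
    using True r by (simp_all add: lefthit_def righthit_def lowhit_def tophit_def)
  show ?thesis
  proof (cases "lefthit i j \<and> lowhit i j")
    case both: True
    then have hv: "h i j = h (i - 1) j + 1" "v i j = v i (j - 1) + 1"
      by (simp_all add: lefthit_def lowhit_def)
    have "zero (i - 1) (j - 1) = zero i j \<and> one (i - 1) (j - 1) = one i j"
    proof (cases "zero i j \<or> one i j")
      case nt: True
      then show ?thesis
        using both_hits_diagonal[of i j] both assms(1) zeroD(5) oneD(5) by (auto simp: mixed_diag_def)
    next
      case False
      then have "h i j \<noteq> v i j"
        using r by (auto intro: box_trichotomy[of i j])
      then have "\<not> (zero (i - 1) (j - 1) \<or> one (i - 1) (j - 1))"
        using hv zeroD(7,8)[of "i - 1" "j - 1"] oneD(7,8)[of "i - 1" "j - 1"] by auto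
      with False show ?thesis by simp
    qed
    then have same: "zero (i - 1) (j - 1) = zero i j" "one (i - 1) (j - 1) = one i j" by simp_all
    have "in_factor i j = out_factor (i - 1) (j - 1)" unfolding in_factor_def out_factor_def same using hv by simp
    then show ?thesis by (simp add: hits)
  qed (auto simp: hits)
qed

section \<open>The balance of the box weights\<close>

definition in_weight where
  "in_weight i j = (if mixed_diag (i - 1) (j - 1) then 0 else
     t ^ of_bool (zero i j \<and> \<not> zero_diag (i - 1) (j - 1)) *
     (1 - t) ^ of_bool (one i j \<and> \<not> (one (i - 1) j \<or> one i (j - 1) \<or> one_diag (i - 1) (j - 1))) *
     (if lefthit i j \<or> lowhit i j then 1 else in_factor i j))"

definition out_weight where
  "out_weight i j = (if mixed_diag i j then 0 else
     t ^ of_bool (zero i j \<and> \<not> zero_diag i j) *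
     (1 - t) ^ of_bool (one i j \<and> \<not> (one (i + 1) j \<or> one i (j + 1) \<or> one_diag i j)) *
     (if righthit i j \<or> tophit i j then 1 else out_factor i j))"

definition rowphi where
  "rowphi j = (\<Prod>i\<in>{0..<m}. if i + 1 < m \<and> h (i + 1) j = h i j + 1 then 1 else qnum t (M (i + 1) j (h i j + 1)))"

definition colpsi where
  "colpsi i = (\<Prod>j\<in>{0..<n}. if 0 < j \<and> v i j = v i (j - 1) + 1 then 1 else qnum t (M i j (v i j)))"

lemma zero_outside [simp]: "\<not> zero (-1) j" "\<not> zero i (-1)" "\<not> zero m j" "\<not> zero i n"
  by (simp_all add: zero_def)

lemma one_outside [simp]: "\<not> one (-1) j" "\<not> one i (-1)" "\<not> one m j" "\<not> one i n"
  by (simp_all add: one_def)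

lemma diagonals_outside:
  "\<not> zero_diag (-1) j" "\<not> zero_diag i (-1)" "\<not> zero_diag (m - 1) j" "\<not> zero_diag i (n - 1)"
  "\<not> one_diag (-1) j" "\<not> one_diag i (-1)" "\<not> one_diag (m - 1) j" "\<not> one_diag i (n - 1)"
  by (simp_all add: zero_diag_def one_diag_def)

lemma t_exponent:
  "(\<Sum>i\<in>{0..<m}. \<Sum>j\<in>{0..<n}. of_bool (zero i j \<and> \<not> zero_diag (i - 1) (j - 1)) :: nat) =
   (\<Sum>i\<in>{0..<m}. \<Sum>j\<in>{0..<n}. of_bool (zero i j \<and> \<not> zero_diag i j))" (is "?A = ?B")
proof -
  let ?S = "\<lambda>f. \<Sum>i\<in>{0..<m}. \<Sum>j\<in>{0..<n}. f i j :: nat"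
  have "?A + ?S (\<lambda>i j. of_bool (zero_diag (i - 1) (j - 1))) = ?S (\<lambda>i j. of_bool (zero i j))"
    unfolding sum.distrib[symmetric] by (intro sum.cong refl) (auto simp: zero_diag_def)
  moreover have "?B + ?S (\<lambda>i j. of_bool (zero_diag i j)) = ?S (\<lambda>i j. of_bool (zero i j))"
    unfolding sum.distrib[symmetric] by (intro sum.cong refl) (auto simp: zero_diag_def)
  moreover have "?S (\<lambda>i j. of_bool (zero_diag (i - 1) (j - 1))) = ?S (\<lambda>i j. of_bool (zero_diag i j))"
    by (rule double_sum_shift) (simp_all add: diagonals_outside)
  ultimately show ?thesis by linarith
qed

text \<open>
By inclusion and exclusion, the number of one-boxes without predecessor is the number of one-boxes
minus the number of adjacent pairs (horizontal, vertical, diagonal) plus the number of diagonal pairs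
completed by a box on the left, respectively below. No further terms arise, since
predecessors on the left and below force a diagonal one. Counting one-boxes without
successor gives the same pairs and triples, shifted by one box.
\<close>

lemma one_minus_t_exponent:
  "(\<Sum>i\<in>{0..<m}. \<Sum>j\<in>{0..<n}.
      of_bool (one i j \<and> \<not> (one (i - 1) j \<or> one i (j - 1) \<or> one_diag (i - 1) (j - 1))) :: nat) =
   (\<Sum>i\<in>{0..<m}. \<Sum>j\<in>{0..<n}.
      of_bool (one i j \<and> \<not> (one (i + 1) j \<or> one i (j + 1) \<or> one_diag i j)))" (is "?A = ?B")
proof -
  let ?S = "\<lambda>f. \<Sum>i\<in>{0..<m}. \<Sum>j\<in>{0..<n}. f i j :: nat"
  let ?O = "\<lambda>i j. of_bool (one i j) :: nat"
  let ?D = "\<lambda>i j. of_bool (one_diag i j) :: nat"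
  let ?H = "\<lambda>i j. of_bool (one i j \<and> one (i + 1) j) :: nat"
  let ?V = "\<lambda>i j. of_bool (one i j \<and> one i (j + 1)) :: nat"
  let ?X = "\<lambda>i j. of_bool (one_diag i j \<and> one i (j + 1)) :: nat"
  let ?Y = "\<lambda>i j. of_bool (one_diag i j \<and> one (i + 1) j) :: nat"
  have "?A + (?S (\<lambda>i j. ?D (i - 1) (j - 1)) + (?S (\<lambda>i j. ?H (i - 1) j) + ?S (\<lambda>i j. ?V i (j - 1)))) =
      ?S ?O + (?S (\<lambda>i j. ?X (i - 1) (j - 1)) + ?S (\<lambda>i j. ?Y (i - 1) (j - 1)))"
    unfolding sum.distrib[symmetric]
  proof (intro sum.cong refl)
    fix i j
    show "of_bool (one i j \<and> \<not> (one (i - 1) j \<or> one i (j - 1) \<or> one_diag (i - 1) (j - 1))) +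
        (?D (i - 1) (j - 1) + (?H (i - 1) j + ?V i (j - 1))) =
        ?O i j + (?X (i - 1) (j - 1) + ?Y (i - 1) (j - 1))"
      using one_left_and_below[of i j] one_diag_def[of "i - 1" "j - 1"] by auto
  qed
  moreover have "?B + (?S ?D + (?S ?H + ?S ?V)) = ?S ?O + (?S ?X + ?S ?Y)"
    unfolding sum.distrib[symmetric]
  proof (intro sum.cong refl)
    fix i j
    show "of_bool (one i j \<and> \<not> (one (i + 1) j \<or> one i (j + 1) \<or> one_diag i j)) +
        (?D i j + (?H i j + ?V i j)) = ?O i j + (?X i j + ?Y i j)"
      using one_right_and_above[of i j] one_diag_def[of i j] by auto
  qed
  moreover have "?S (\<lambda>i j. ?D (i - 1) (j - 1)) = ?S ?D" "?S (\<lambda>i j. ?X (i - 1) (j - 1)) = ?S ?X"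
    "?S (\<lambda>i j. ?Y (i - 1) (j - 1)) = ?S ?Y"
    by (rule double_sum_shift; simp add: diagonals_outside)+
  moreover have "?S (\<lambda>i j. ?V i (j - 1)) = ?S ?V"
    by (intro sum.cong refl sum_int_shift) simp_all
  moreover have "?S (\<lambda>i j. ?H (i - 1) j) = ?S ?H"
    by (rule sum_int_shift) simp_all
  ultimately show ?thesis by linarith
qed

lemma mixed_diag_inside: "mixed_diag i j \<Longrightarrow> 0 \<le> i \<and> i + 1 < m \<and> 0 \<le> j \<and> j + 1 < n"
  unfolding mixed_diag_def zero_def one_def by linarith

text \<open>
The telescoped form of the four exchange relations. All factors are nonzero, so those for hits from one side,
which occur in the inclusion-exclusion formula with exponent -1, can be cancelled at the end.
\<close>

lemma boundary_balance:
  assumes nomis: "\<And>i j. \<not> mixed_diag i j"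
  shows "(\<Prod>i\<in>{0..<m}. \<Prod>j\<in>{0..<n}. if lefthit i j \<or> lowhit i j then 1 else in_factor i j) *
      (rowphi 0 * colpsi 0) =
    rowphi n * colpsi m *
      (\<Prod>i\<in>{0..<m}. \<Prod>j\<in>{0..<n}. if righthit i j \<or> tophit i j then 1 else out_factor i j)"
proof -
  let ?P = "\<lambda>f. \<Prod>i\<in>{0..<m}. \<Prod>j\<in>{0..<n}. f i j :: real"
  let ?in = "\<lambda>B i j. if B i j then in_factor i j else 1"
  let ?out = "\<lambda>B i j. if B i j then out_factor i j else 1"
  let ?none_in = "?P (?in (\<lambda>i j. \<not> (lefthit i j \<or> lowhit i j)))"
  let ?none_out = "?P (?out (\<lambda>i j. \<not> (righthit i j \<or> tophit i j)))"
  let ?both_in = "?P (?in (\<lambda>i j. lefthit i j \<and> lowhit i j))"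
  let ?both_out = "?P (?out (\<lambda>i j. righthit i j \<and> tophit i j))"
  define a where "a j = (\<Prod>i\<in>{0..<m}. qnum t (M (i + 1) j (h i j + 1)))" for j
  define b where "b i = (\<Prod>j\<in>{0..<n}. qnum t (M i j (v i j)))" for i
  define pr where "pr j = (\<Prod>i\<in>{0..<m}. left_corner i j)" for j
  define pc where "pc i = (\<Prod>j\<in>{0..<n}. low_corner i j)" for i
  have nz: "?P (?in lefthit) \<noteq> 0" "?P (?in lowhit) \<noteq> 0" "?P (?out righthit) \<noteq> 0" "?P (?out tophit) \<noteq> 0"
    using in_factor_nonzero out_factor_nonzero by simp_all
  have a_nz: "a j \<noteq> 0" if "0 \<le> j" "j \<le> n" for j
    unfolding a_def using qnum_count_h(1)[of _ j] that by simp
  have b_nz: "b i \<noteq> 0" if "0 \<le> i" "i \<le> m" for i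
    unfolding b_def using qnum_count_v(2)[of i] that by simp
  have pr_nz: "pr j \<noteq> 0" if "0 \<le> j" "j \<le> n" for j
    unfolding pr_def left_corner_def using qnum_count_h(2)[of _ j] that by simp
  have pc_nz: "pc i \<noteq> 0" if "0 \<le> i" "i \<le> m" for i
    unfolding pc_def low_corner_def using qnum_count_v(2)[of i] that by simp
  have row: "rowphi j * pr j = a j" if j: "0 \<le> j" "j \<le> n" for j
  proof -
    let ?f = "\<lambda>i. if 0 \<le> i \<and> i + 1 < m \<and> h (i + 1) j = h i j + 1 then qnum t (M (i + 1) j (h i j + 1)) else 1"
    have "pr j = (\<Prod>i\<in>{0..<m}. ?f (i - 1))"
      unfolding pr_def left_corner_def lefthit_def by (intro prod.cong refl) auto
    also have "\<dots> = (\<Prod>i\<in>{0..<m}. ?f i)" by (rule prod_int_shift) simp_all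
    finally have pr: "pr j = (\<Prod>i\<in>{0..<m}. ?f i)" .
    show ?thesis
      unfolding rowphi_def a_def pr prod.distrib[symmetric] by (intro prod.cong refl) auto
  qed
  have col: "colpsi i * pc i = b i" for i
    unfolding colpsi_def pc_def b_def low_corner_def lowhit_def prod.distrib[symmetric]
    by (intro prod.cong refl) auto
  have boxes: "a 0 * (b 0 * ?P in_factor) = a n * (b m * ?P out_factor)"
  proof -
    let ?bot = "\<lambda>i j. qnum t (M (i + 1) j (h i j + 1))"
    let ?top = "\<lambda>i j. qnum t (M (i + 1) (j + 1) (h i (j + 1) + 1))"
    have vert: "b 0 * (?P ?bot * ?P in_factor) = b m * (?P ?top * ?P out_factor)"
      unfolding prod.distrib[symmetric]
    proof (rule prod_telescope[OF m_nonneg])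
      fix i assume i: "0 \<le> i" "i < m"
      show "b i * (\<Prod>j\<in>{0..<n}. ?bot i j * in_factor i j) = b (i + 1) * (\<Prod>j\<in>{0..<n}. ?top i j * out_factor i j)"
        unfolding b_def prod.distrib[symmetric]
      proof (rule prod.cong)
        fix j assume "j \<in> {0..<n}"
        then show "qnum t (M i j (v i j)) * (?bot i j * in_factor i j) =
          qnum t (M (i + 1) j (v (i + 1) j)) * (?top i j * out_factor i j)"
          using box_exchange[of i j] i by (simp only: mult_ac atLeastLessThan_iff)
      qed simp
    qed (use b_nz in auto)
    have hor: "a 0 * ?P ?top = a n * ?P ?bot"
    proof -
      have "a 0 * (\<Prod>j\<in>{0..<n}. a (j + 1)) = a n * (\<Prod>j\<in>{0..<n}. a j)"
        by (rule prod_telescope[OF n_nonneg]) (use a_nz in \<open>auto simp: mult.commute\<close>)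
      then show ?thesis unfolding a_def by (simp only: prod.swap[of _ "{0..<n}" "{0..<m}"])
    qed
    have bot: "?P ?bot \<noteq> 0" using qnum_count_h(1) by simp
    have "?P ?bot * (a 0 * (b 0 * ?P in_factor)) = a 0 * (b 0 * (?P ?bot * ?P in_factor))" by (simp only: mult_ac)
    also have "\<dots> = b m * ?P out_factor * (a 0 * ?P ?top)" unfolding vert by (simp only: mult_ac)
    also have "\<dots> = ?P ?bot * (a n * (b m * ?P out_factor))" unfolding hor by (simp only: mult_ac)
    finally show ?thesis unfolding mult_left_cancel[OF bot] .
  qed
  have left: "pr 0 * ?P (?in lefthit) = pr n * ?P (?out righthit)"
  proof -
    have "pr 0 * (\<Prod>j\<in>{0..<n}. \<Prod>i\<in>{0..<m}. ?in lefthit i j) =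
        pr n * (\<Prod>j\<in>{0..<n}. \<Prod>i\<in>{0..<m}. ?out righthit i j)"
    proof (rule prod_telescope[OF n_nonneg])
      fix j assume j: "0 \<le> j" "j < n"
      have "pr j * (\<Prod>i\<in>{0..<m}. ?in lefthit i j) = pr (j + 1) * (\<Prod>i\<in>{0..<m}. ?out righthit (i - 1) j)"
        unfolding pr_def prod.distrib[symmetric]
        by (intro prod.cong refl adjacent_exchange) (use j in auto)
      also have "(\<Prod>i\<in>{0..<m}. ?out righthit (i - 1) j) = (\<Prod>i\<in>{0..<m}. ?out righthit i j)"
        by (rule prod_int_shift) (simp_all add: out_factor_def righthit_def)
      finally show "pr j * (\<Prod>i\<in>{0..<m}. ?in lefthit i j) = pr (j + 1) * (\<Prod>i\<in>{0..<m}. ?out righthit i j)" .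
    qed (use pr_nz in auto)
    then show ?thesis by (simp only: prod.swap[of _ "{0..<n}" "{0..<m}"])
  qed
  have low: "pc 0 * ?P (?in lowhit) = pc m * ?P (?out tophit)"
  proof (rule prod_telescope[OF m_nonneg])
    fix i assume i: "0 \<le> i" "i < m"
    have "pc i * (\<Prod>j\<in>{0..<n}. ?in lowhit i j) = pc (i + 1) * (\<Prod>j\<in>{0..<n}. ?out tophit i (j - 1))"
      unfolding pc_def prod.distrib[symmetric]
      by (intro prod.cong refl adjacent_exchange_v) (use i in auto)
    also have "(\<Prod>j\<in>{0..<n}. ?out tophit i (j - 1)) = (\<Prod>j\<in>{0..<n}. ?out tophit i j)"
      by (rule prod_int_shift) (simp_all add: out_factor_def tophit_def)
    finally show "pc i * (\<Prod>j\<in>{0..<n}. ?in lowhit i j) = pc (i + 1) * (\<Prod>j\<in>{0..<n}. ?out tophit i j)" .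
  qed (use pc_nz in auto)
  have both: "?both_in = ?both_out"
  proof -
    let ?f = "?out (\<lambda>i j. righthit i j \<and> tophit i j)"
    have "?both_in = ?P (\<lambda>i j. ?f (i - 1) (j - 1))"
      by (intro prod.cong refl diagonal_exchange) (use nomis in auto)
    also have "\<dots> = ?P ?f"
      by (rule double_prod_shift) (simp_all add: out_factor_def righthit_def tophit_def)
    finally show ?thesis .
  qed
  have split_in: "?none_in * (?P (?in lefthit) * ?P (?in lowhit)) = ?P in_factor * ?both_in"
    unfolding prod.distrib[symmetric] by (intro prod.cong refl) auto
  have split_out: "?none_out * (?P (?out righthit) * ?P (?out tophit)) = ?P out_factor * ?both_out"
    unfolding prod.distrib[symmetric] by (intro prod.cong refl) auto
  have none: "(\<Prod>i\<in>{0..<m}. \<Prod>j\<in>{0..<n}. if lefthit i j \<or> lowhit i j then 1 else in_factor i j) = ?none_in"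
    "(\<Prod>i\<in>{0..<m}. \<Prod>j\<in>{0..<n}. if righthit i j \<or> tophit i j then 1 else out_factor i j) = ?none_out"
    by (intro prod.cong refl; auto)+
  \<comment> \<open>Multiplied by the corner factors and the factors of single hits, both sides are products
    of quantities covered by the exchange relations.\<close>
  have "?none_in * (rowphi 0 * colpsi 0) * ((pr 0 * ?P (?in lefthit)) * (pc 0 * ?P (?in lowhit))) =
      (?none_in * (?P (?in lefthit) * ?P (?in lowhit))) * ((rowphi 0 * pr 0) * (colpsi 0 * pc 0))"
    by (simp only: mult_ac)
  also have "\<dots> = a 0 * (b 0 * ?P in_factor) * ?both_in"
    unfolding split_in col row[OF order_refl n_nonneg] by (simp only: mult_ac)
  also have "\<dots> = (?none_out * (?P (?out righthit) * ?P (?out tophit))) * ((rowphi n * pr n) * (colpsi m * pc m))"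
    unfolding boxes both split_out col row[OF n_nonneg order_refl] by (simp only: mult_ac)
  also have "\<dots> = rowphi n * colpsi m * ?none_out * ((pr n * ?P (?out righthit)) * (pc m * ?P (?out tophit)))"
    by (simp only: mult_ac)
  finally have "?none_in * (rowphi 0 * colpsi 0) * ((pr 0 * ?P (?in lefthit)) * (pc 0 * ?P (?in lowhit))) =
      rowphi n * colpsi m * ?none_out * ((pr 0 * ?P (?in lefthit)) * (pc 0 * ?P (?in lowhit)))"
    unfolding left low .
  moreover have nonzero: "(pr 0 * ?P (?in lefthit)) * (pc 0 * ?P (?in lowhit)) \<noteq> 0"
    using nz(1,2) pr_nz[of 0] pc_nz[of 0] m_nonneg n_nonneg by simp
  ultimately show ?thesis unfolding none mult_right_cancel[OF nonzero] by blast
qed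

text \<open>
A mixed diagonal pair makes \<open>in_weight\<close> vanish at its north-east box and \<open>out_weight\<close> at its
south-west box. Without such pairs the three parts of the weights are compared separately.
\<close>

theorem weights_balance:
  "(\<Prod>i\<in>{0..<m}. \<Prod>j\<in>{0..<n}. in_weight i j) * (rowphi 0 * colpsi 0) =
    rowphi n * colpsi m * (\<Prod>i\<in>{0..<m}. \<Prod>j\<in>{0..<n}. out_weight i j)"
proof (cases "\<exists>i j. mixed_diag i j")
  case True
  then obtain i j where mixed_diag: "mixed_diag i j" by blast
  note r = mixed_diag_inside[OF mixed_diag]
  have "in_weight (i + 1) (j + 1) = 0" "out_weight i j = 0" using mixed_diag by (simp_all add: in_weight_def out_weight_def)
  then have "(\<Prod>i\<in>{0..<m}. \<Prod>j\<in>{0..<n}. in_weight i j) = 0" "(\<Prod>i\<in>{0..<m}. \<Prod>j\<in>{0..<n}. out_weight i j) = 0"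
    using r by (force simp: prod_zero_iff)+
  then show ?thesis by (simp only: mult_zero_left mult_zero_right)
next
  case False
  then have nomis: "\<not> mixed_diag i j" for i j by blast
  let ?S = "\<lambda>B. \<Sum>i\<in>{0..<m}. \<Sum>j\<in>{0..<n}. of_bool (B i j) :: nat"
  let ?none_in = "\<Prod>i\<in>{0..<m}. \<Prod>j\<in>{0..<n}. if lefthit i j \<or> lowhit i j then 1 else in_factor i j"
  let ?none_out = "\<Prod>i\<in>{0..<m}. \<Prod>j\<in>{0..<n}. if righthit i j \<or> tophit i j then 1 else out_factor i j"
  let ?x = "t ^ ?S (\<lambda>i j. zero i j \<and> \<not> zero_diag i j)"
  let ?y = "(1 - t) ^ ?S (\<lambda>i j. one i j \<and> \<not> (one (i + 1) j \<or> one i (j + 1) \<or> one_diag i j))"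
  have in_weight: "(\<Prod>i\<in>{0..<m}. \<Prod>j\<in>{0..<n}. in_weight i j) = ?x * ?y * ?none_in"
    unfolding t_exponent[symmetric] one_minus_t_exponent[symmetric]
    by (simp only: in_weight_def nomis if_False power_sum prod.distrib)
  have out_weight: "(\<Prod>i\<in>{0..<m}. \<Prod>j\<in>{0..<n}. out_weight i j) = ?x * ?y * ?none_out"
    by (simp only: out_weight_def nomis if_False power_sum prod.distrib)
  have "?x * ?y * ?none_in * (rowphi 0 * colpsi 0) = ?x * ?y * (?none_in * (rowphi 0 * colpsi 0))"
    by (simp only: mult.assoc)
  also have "\<dots> = ?x * ?y * (rowphi n * colpsi m * ?none_out)"
    unfolding boundary_balance[OF nomis] ..
  also have "\<dots> = rowphi n * colpsi m * (?x * ?y * ?none_out)"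
    by (simp only: mult_ac)
  finally show ?thesis unfolding in_weight out_weight .
qed

lemma rowphi_nonzero: "0 \<le> j \<Longrightarrow> j \<le> n \<Longrightarrow> rowphi j \<noteq> 0"
  unfolding rowphi_def using qnum_count_h(1)[of _ j] by simp

lemma colpsi_nonzero: "0 \<le> i \<Longrightarrow> i \<le> m \<Longrightarrow> colpsi i \<noteq> 0"
  unfolding colpsi_def using qnum_count_v(2)[of i] by simp

section \<open>Reversal and boundary products\<close>

lemma in_weight_reversed:
  "weighted_grid.in_weight m n (\<lambda>i j. - 1 - h (m - 1 - i) (n - j)) (\<lambda>i j. - 1 - v (m - i) (n - 1 - j))
    (\<lambda>i j x. M (m - i) (n - j) (- x)) t (m - 1 - i) (n - 1 - j) = out_weight i j"
proof -
  interpret rv: weighted_grid m n "\<lambda>i j. - 1 - h (m - 1 - i) (n - j)"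
    "\<lambda>i j. - 1 - v (m - i) (n - 1 - j)" "\<lambda>i j x. M (m - i) (n - j) (- x)" t
    using reversed t_nonneg t_less_1 by (simp add: weighted_grid_def weighted_grid_axioms_def)
  have idx: "m - 1 - (m - 1 - i) = i" "n - 1 - (n - 1 - j) = j" "m - (m - 1 - i) = i + 1"
    "n - (n - 1 - j) = j + 1" "n - (n - 1 - j + 1) = j" "m - (m - 1 - i + 1) = i"
    "m - 1 - i - 1 = m - 1 - (i + 1)" "n - 1 - j - 1 = n - 1 - (j + 1)" for i j
    by simp_all
  have zero: "rv.zero (m - 1 - i) (n - 1 - j) \<longleftrightarrow> zero i j" for i j
    unfolding rv.zero_def zero_def idx using box_alternatives[of i j] by auto
  have one: "rv.one (m - 1 - i) (n - 1 - j) \<longleftrightarrow> one i j" for i j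
    unfolding rv.one_def one_def idx using box_alternatives[of i j] by auto
  have link: "rv.link (m - 1 - (i + 1)) (n - 1 - (j + 1)) \<longleftrightarrow> link i j"
  proof -
    have *: "m - 1 - (m - 1 - (i + 1) + 1) = i" "n - (n - 1 - (j + 1) + 1) = j + 1"
      "m - 1 - (m - 1 - (i + 1)) = i + 1" by simp_all
    show ?thesis unfolding rv.link_def link_def * by auto
  qed
  have step: "m - 1 - (i + 1) + 1 = m - 1 - i" "n - 1 - (j + 1) + 1 = n - 1 - j" by simp_all
  have diag: "rv.zero_diag (m - 1 - (i + 1)) (n - 1 - (j + 1)) \<longleftrightarrow> zero_diag i j"
    "rv.one_diag (m - 1 - (i + 1)) (n - 1 - (j + 1)) \<longleftrightarrow> one_diag i j"
    "rv.mixed_diag (m - 1 - (i + 1)) (n - 1 - (j + 1)) \<longleftrightarrow> mixed_diag i j"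
    unfolding rv.zero_diag_def zero_diag_def rv.one_diag_def one_diag_def rv.mixed_diag_def mixed_diag_def link step zero one by auto
  have hits: "rv.lefthit (m - 1 - i) (n - 1 - j) \<longleftrightarrow> righthit i j"
    "rv.lowhit (m - 1 - i) (n - 1 - j) \<longleftrightarrow> tophit i j"
    unfolding rv.lefthit_def righthit_def rv.lowhit_def tophit_def idx by auto
  have in_factor: "rv.in_factor (m - 1 - i) (n - 1 - j) = out_factor i j"
    unfolding rv.in_factor_def out_factor_def zero one idx by (simp add: add.commute)
  show ?thesis
    unfolding rv.in_weight_def out_weight_def idx zero one diag hits in_factor ..
qed

text \<open>
The particle number rises at \<open>x\<close> along the row exactly if there is a move from \<open>x - 1\<close> but none
from \<open>x\<close>. Such an \<open>x\<close> is the target of an edge whose successor is not at the adjacent position, and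
the later moves of the row leave \<open>x\<close> alone.
\<close>

lemma rowphi_by_positions:
  assumes j: "0 \<le> j" "j \<le> n"
  shows "(\<Prod>x\<in>{x. M m j x = Suc (M 0 j x)}. qnum t (M m j x)) = rowphi j"
proof -
  let ?H = "\<lambda>k. (\<lambda>i. h i j) ` {0..<k}"
  let ?I = "{i\<in>{0..<m}. \<not> (i + 1 < m \<and> h (i + 1) j = h i j + 1)}"
  let ?S = "{x. M m j x = Suc (M 0 j x)}"
  have S: "x \<in> ?S \<longleftrightarrow> x - 1 \<in> ?H m \<and> x \<notin> ?H m" for x
    using row_count[OF m_nonneg order_refl j, of x]
    by (cases "x \<in> ?H m"; cases "x - 1 \<in> ?H m") simp_all
  have free: "h i j + 1 \<notin> ?H m" if i: "0 \<le> i" "i < m" "\<not> (i + 1 < m \<and> h (i + 1) j = h i j + 1)" for i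
  proof
    assume "h i j + 1 \<in> ?H m"
    then obtain k where k: "0 \<le> k" "k < m" "h k j = h i j + 1" by auto
    consider "k < i" | "k = i" | "k = i + 1" | "i + 1 < k" by linarith
    then show False
    proof cases
      case 1
      then show ?thesis using row_increasing[of k i j] k i j by simp
    next
      case 4
      then show ?thesis
        using row_increasing[of i "i + 1" j] row_increasing[of "i + 1" k j] k i j by simp
    qed (use k i in auto)
  qed
  have bij: "bij_betw (\<lambda>i. h i j + 1) ?I ?S"
  proof (rule bij_betw_imageI)
    show "inj_on (\<lambda>i. h i j + 1) ?I"
    proof (rule linorder_inj_onI)
      fix i k assume "i < k" "i \<in> ?I" "k \<in> ?I"
      then show "h i j + 1 \<noteq> h k j + 1" using row_increasing[of i k j] j by simp
    qed auto
    show "(\<lambda>i. h i j + 1) ` ?I = ?S"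
    proof (intro set_eqI iffI)
      fix x assume "x \<in> (\<lambda>i. h i j + 1) ` ?I"
      then show "x \<in> ?S" unfolding S using free by auto
    next
      fix x assume "x \<in> ?S"
      then obtain i where i: "0 \<le> i" "i < m" "x = h i j + 1" "x \<notin> ?H m"
        unfolding S by (auto simp: algebra_simps)
      have "\<not> (i + 1 < m \<and> h (i + 1) j = h i j + 1)"
      proof
        assume next_hit: "i + 1 < m \<and> h (i + 1) j = h i j + 1"
        have "h (i + 1) j \<in> ?H m" by (rule imageI) (use i next_hit in simp)
        then show False using i(3,4) next_hit by metis
      qed
      then show "x \<in> (\<lambda>i. h i j + 1) ` ?I" using i(1-3) by auto
    qed
  qed
  have same: "M m j (h i j + 1) = M (i + 1) j (h i j + 1)" if i: "i \<in> ?I" for i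
  proof -
    have "h i j + 1 \<notin> ?H m" "h i j \<in> ?H (i + 1)" using free i by auto
    moreover have "?H (i + 1) \<subseteq> ?H m" using i by auto
    ultimately have "h i j + 1 \<notin> ?H (i + 1)" "h i j \<in> ?H (i + 1)" "h i j \<in> ?H m" "h i j + 1 \<notin> ?H m"
      by blast+
    then show ?thesis
      using row_count[of "i + 1" j "h i j + 1"] row_count[of m j "h i j + 1"] i j by simp
  qed
  have "(\<Prod>x\<in>?S. qnum t (M m j x)) = (\<Prod>i\<in>?I. qnum t (M m j (h i j + 1)))"
    using prod.reindex_bij_betw[OF bij, of "\<lambda>x. qnum t (M m j x)"] by simp
  also have "\<dots> = (\<Prod>i\<in>?I. qnum t (M (i + 1) j (h i j + 1)))"
    using same by (intro prod.cong) simp_all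
  also have "\<dots> = rowphi j"
    unfolding rowphi_def by (subst prod.inter_filter) (auto intro!: prod.cong)
  finally show ?thesis .
qed

text \<open>
The particle number falls at \<open>x\<close> along the column exactly if there is a move from \<open>x\<close> but none from
\<open>x - 1\<close>, that is, for an edge whose predecessor is not at the adjacent position.
\<close>

lemma colpsi_by_positions:
  assumes i: "0 \<le> i" "i \<le> m"
  shows "(\<Prod>x\<in>{x. M i 0 x = Suc (M i n x)}. qnum t (M i 0 x)) = colpsi i"
proof -
  let ?V = "\<lambda>k. v i ` {0..<k}"
  let ?J = "{j\<in>{0..<n}. \<not> (0 < j \<and> v i j = v i (j - 1) + 1)}"
  let ?S = "{x. M i 0 x = Suc (M i n x)}"
  have S: "x \<in> ?S \<longleftrightarrow> x \<in> ?V n \<and> x - 1 \<notin> ?V n" for x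
    using col_count[OF n_nonneg order_refl i, of x]
    by (cases "x \<in> ?V n"; cases "x - 1 \<in> ?V n") simp_all
  have free: "v i j - 1 \<notin> ?V n" if j: "0 \<le> j" "j < n" "\<not> (0 < j \<and> v i j = v i (j - 1) + 1)" for j
  proof
    assume "v i j - 1 \<in> ?V n"
    then obtain k where k: "0 \<le> k" "k < n" "v i k = v i j - 1" by auto
    consider "j < k" | "k = j" | "k = j - 1" | "k < j - 1" by linarith
    then show False
    proof cases
      case 1
      then show ?thesis using col_increasing[of j k i] k i j by simp
    next
      case 4
      then show ?thesis
        using col_increasing[of "j - 1" j i] col_increasing[of k "j - 1" i] k i j by simp
    qed (use k j in auto)
  qed
  have bij: "bij_betw (v i) ?J ?S"
  proof (rule bij_betw_imageI)
    show "inj_on (v i) ?J"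
    proof (rule linorder_inj_onI)
      fix j k assume "j < k" "j \<in> ?J" "k \<in> ?J"
      then show "v i j \<noteq> v i k" using col_increasing[of j k i] i by simp
    qed auto
    show "v i ` ?J = ?S"
    proof (intro set_eqI iffI)
      fix x assume "x \<in> v i ` ?J"
      then obtain j where j: "j \<in> ?J" "x = v i j" by blast
      have "v i j - 1 \<notin> ?V n" by (rule free) (use j in simp_all)
      moreover have "v i j \<in> ?V n" using j by simp
      ultimately show "x \<in> ?S" unfolding S j(2) by blast
    next
      fix x assume "x \<in> ?S"
      then obtain j where j: "0 \<le> j" "j < n" "x = v i j" "x - 1 \<notin> ?V n"
        unfolding S by auto
      have "\<not> (0 < j \<and> v i j = v i (j - 1) + 1)"
      proof
        assume hit: "0 < j \<and> v i j = v i (j - 1) + 1"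
        have "v i (j - 1) \<in> ?V n" by (rule imageI) (use j hit in simp)
        then show False using j(3,4) hit by simp
      qed
      then show "x \<in> v i ` ?J" using j(1-3) by auto
    qed
  qed
  have same: "M i 0 (v i j) = M i j (v i j)" if j: "j \<in> ?J" for j
  proof -
    have "v i j - 1 \<notin> ?V n" by (rule free) (use j in simp_all)
    moreover have "?V j \<subseteq> ?V n" using j by auto
    ultimately have "v i j - 1 \<notin> ?V j" by blast
    moreover have "v i j \<notin> ?V j" using col_increasing[of _ j i] i j by force
    ultimately show ?thesis using col_count[of j i "v i j"] i j by simp
  qed
  have "(\<Prod>x\<in>?S. qnum t (M i 0 x)) = (\<Prod>j\<in>?J. qnum t (M i 0 (v i j)))"
    using prod.reindex_bij_betw[OF bij, of "\<lambda>x. qnum t (M i 0 x)"] by simp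
  also have "\<dots> = (\<Prod>j\<in>?J. qnum t (M i j (v i j)))"
    using same by (intro prod.cong) simp_all
  also have "\<dots> = colpsi i"
    unfolding colpsi_def by (subst prod.inter_filter) (auto intro!: prod.cong)
  finally show ?thesis .
qed

end

section \<open>The factors phi and psi as products over positions\<close>

definition indices :: "sig \<Rightarrow> int \<Rightarrow> nat set" where
  "indices \<kappa> x = {k. 1 \<le> k \<and> k \<le> length \<kappa> \<and> part \<kappa> k = Fin x}"

lemma card_indices: "card (indices \<kappa> x) = count (mset \<kappa>) x"
proof -
  have "indices \<kappa> x = Suc ` {i. i < length \<kappa> \<and> x = \<kappa> ! i}"
  proof (intro set_eqI iffI)
    fix k assume "k \<in> indices \<kappa> x"
    then have "k = Suc (k - 1)" "k - 1 < length \<kappa>" "x = \<kappa> ! (k - 1)"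
      by (auto simp: indices_def part_def split: if_splits)
    then show "k \<in> Suc ` {i. i < length \<kappa> \<and> x = \<kappa> ! i}" by blast
  qed (auto simp: indices_def part_def)
  then show ?thesis unfolding count_mset count_list_eq_length_filter length_filter_conv_card by (simp add: card_image)
qed

lemma finite_indices [simp]: "finite (indices \<kappa> x)"
  unfolding indices_def by (rule finite_subset[of _ "{..length \<kappa>}"]) auto

lemma part_antimono:
  assumes "\<kappa> \<in> Sig N" "k \<le> l"
  shows "part \<kappa> l \<le> part \<kappa> k"
proof -
  have "sorted_wrt (\<ge>) \<kappa>" using assms by (simp add: Sig_def)
  then have "\<kappa> ! (l - 1) \<le> \<kappa> ! (k - 1)" if "1 \<le> k" "k < l" "l \<le> length \<kappa>"
    using that sorted_wrt_nth_less[of "(\<ge>)" \<kappa> "k - 1" "l - 1"] by simp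
  then show ?thesis using assms(2) by (cases "k = l") (auto simp: part_def)
qed

locale interlacing_pair =
  fixes N :: nat and \<kappa> \<mu> :: sig
  assumes sig: "\<kappa> \<in> Sig N" "\<mu> \<in> Sig N" and inter: "interlaces \<kappa> \<mu>"
begin

lemma upper: "1 \<le> k \<Longrightarrow> k \<le> N \<Longrightarrow> part \<kappa> k \<le> part \<mu> k"
  and lower: "1 \<le> k \<Longrightarrow> k \<le> N \<Longrightarrow> part \<mu> (k + 1) \<le> part \<kappa> k"
  using inter sig by (simp_all add: interlaces_def Sig_def)

lemma indices_iff: "l \<in> indices \<kappa> x \<longleftrightarrow> 1 \<le> l \<and> l \<le> N \<and> part \<kappa> l = Fin x"
  "l \<in> indices \<mu> x \<longleftrightarrow> 1 \<le> l \<and> l \<le> N \<and> part \<mu> l = Fin x"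
  using sig by (simp_all add: indices_def Sig_def)

text \<open>
The index pairs in the definition of \<open>\<phi>\<close> are the end points of those blocks of equal parts of
\<open>\<mu>\<close> whose neighbours in \<open>\<kappa>\<close> differ on both sides. Interlacing pins the parts of \<open>\<kappa>\<close> strictly
inside the block, so \<open>\<kappa>\<close> has exactly one part fewer of this value.
\<close>

lemma phi_block:
  assumes kj: "1 \<le> k" "k \<le> j" "j \<le> N"
    and "part \<kappa> j < part \<mu> j" "part \<mu> j = Fin x" "part \<mu> k = Fin x" "part \<mu> k < part \<kappa> (k - 1)"
  shows "indices \<mu> x = {k..j}" "indices \<kappa> x = {k..<j}"
proof -
  have above: "Fin x < part \<kappa> l" if "l < k" for l
  proof -
    have "part \<kappa> (k - 1) \<le> part \<kappa> l" using part_antimono[OF sig(1), of l "k - 1"] that by simp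
    then show ?thesis using assms by (metis less_le_trans)
  qed
  have above': "Fin x < part \<mu> l" if "l < k" for l
  proof (cases "l = 0")
    case False
    then show ?thesis using upper[of l] above[OF that] that kj by (auto intro: less_le_trans)
  qed (simp add: part_def)
  have below: "part \<kappa> l < Fin x" if "j \<le> l" for l
    using part_antimono[OF sig(1) that] assms by auto
  have below': "part \<mu> l < Fin x" if "j < l" for l
    using lower[of j] part_antimono[OF sig(2), of "j + 1" l] below[of j] that kj by auto
  have inside': "part \<mu> l = Fin x" if "k \<le> l" "l \<le> j" for l
    using part_antimono[OF sig(2) that(1)] part_antimono[OF sig(2) that(2)] assms by auto
  have inside: "part \<kappa> l = Fin x" if "k \<le> l" "l < j" for l
    using upper[of l] lower[of l] inside'[of l] inside'[of "l + 1"] that kj by auto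
  show "indices \<mu> x = {k..j}"
  proof (intro set_eqI)
    fix l
    show "l \<in> indices \<mu> x \<longleftrightarrow> l \<in> {k..j}"
      using above'[of l] below'[of l] inside'[of l] kj
      by (cases "l < k"; cases "j < l") (auto simp: indices_iff)
  qed
  show "indices \<kappa> x = {k..<j}"
  proof (intro set_eqI)
    fix l
    show "l \<in> indices \<kappa> x \<longleftrightarrow> l \<in> {k..<j}"
      using above[of l] below[of l] inside[of l] kj
      by (cases "l < k"; cases "j \<le> l") (auto simp: indices_iff)
  qed
qed

text \<open>
Conversely, interlacing forces \<open>j - k\<close> parts of \<open>\<kappa>\<close> into a block \<open>k..j\<close> of \<open>\<mu>\<close>. If there are no
more of this value, the parts of \<open>\<kappa>\<close> at both ends of the block must differ from it.
\<close>

lemma phi_block_exists: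
  assumes "count (mset \<mu>) x = Suc (count (mset \<kappa>) x)"
  obtains k j where "1 \<le> k" "k \<le> j" "j \<le> N"
    "part \<kappa> j < part \<mu> j" "part \<mu> j = Fin x" "part \<mu> k = Fin x" "part \<mu> k < part \<kappa> (k - 1)"
proof -
  have card: "card (indices \<mu> x) = Suc (card (indices \<kappa> x))" using assms by (simp add: card_indices)
  then have ne: "indices \<mu> x \<noteq> {}" by auto
  define k where "k = Min (indices \<mu> x)"
  define j where "j = Max (indices \<mu> x)"
  have k: "k \<in> indices \<mu> x" and j: "j \<in> indices \<mu> x"
    unfolding k_def j_def using ne by (simp_all add: Min_in Max_in)
  have kj: "k \<le> l" "l \<le> j" if "l \<in> indices \<mu> x" for l
    unfolding k_def j_def using that by simp_all
  have k': "1 \<le> k" "k \<le> N" "part \<mu> k = Fin x" and j': "1 \<le> j" "j \<le> N" "part \<mu> j = Fin x"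
    using k j by (simp_all add: indices_iff)
  have inside: "part \<kappa> l = Fin x" if "k \<le> l" "l < j" for l
  proof -
    have "part \<mu> l = Fin x"
      using part_antimono[OF sig(2), of l j] part_antimono[OF sig(2), of k l] that k' j' by auto
    moreover have "part \<mu> (l + 1) = Fin x"
      using part_antimono[OF sig(2), of "l + 1" j] part_antimono[OF sig(2), of k "l + 1"] that k' j' by auto
    ultimately show ?thesis using upper[of l] lower[of l] that k' j' by auto
  qed
  have sub: "indices \<mu> x \<subseteq> {k..j}" using kj by auto
  have sup: "{k..<j} \<subseteq> indices \<kappa> x" using inside k' j' by (auto simp: indices_iff)
  have "card (indices \<kappa> x) \<le> j - k" using card card_mono[OF _ sub] kj(1)[OF j] by simp
  then have eq: "indices \<kappa> x = {k..<j}"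
    using card_seteq[OF finite_indices sup] by simp
  have "part \<kappa> j \<noteq> Fin x" using eq j' by (auto simp: indices_iff set_eq_iff)
  then have 1: "part \<kappa> j < part \<mu> j" using upper[of j] j' by auto
  have 2: "part \<mu> k < part \<kappa> (k - 1)"
  proof (cases "k = 1")
    case True
    then show ?thesis using k' by (simp add: part_def)
  next
    case False
    have "k - 1 \<notin> indices \<kappa> x" using eq False k' by auto
    then have "part \<kappa> (k - 1) \<noteq> Fin x" using k' False by (auto simp: indices_iff)
    moreover have "part \<mu> k \<le> part \<kappa> (k - 1)" using lower[of "k - 1"] k' False by simp
    ultimately show ?thesis using k' by auto
  qed
  show ?thesis by (rule that[OF k'(1) kj(1)[OF j] j'(2) 1 j'(3) k'(3) 2])
qed

text \<open>
For \<open>\<psi>\<close> the roles of \<open>\<kappa>\<close> and \<open>\<mu>\<close> are exchanged: the blocks are those of \<open>\<kappa>\<close>, and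
\<open>\<mu>\<close> has one part fewer.
\<close>

lemma psi_block:
  assumes kj: "1 \<le> k" "k \<le> j" "j \<le> N"
    and "part \<mu> (j + 1) < part \<kappa> j" "part \<kappa> j = Fin x" "part \<kappa> k = Fin x" "part \<kappa> k < part \<mu> k"
  shows "indices \<kappa> x = {k..j}" "indices \<mu> x = {k<..j}"
proof -
  have above: "Fin x < part \<mu> l" if "l \<le> k" for l
    using part_antimono[OF sig(2) that] assms by auto
  have above': "Fin x < part \<kappa> l" if "l < k" for l
  proof (cases "l = 0")
    case False
    then show ?thesis using lower[of l] above[of "l + 1"] that kj by (auto intro: less_le_trans)
  qed (simp add: part_def)
  have below: "part \<mu> l < Fin x" if "j < l" for l
    using part_antimono[OF sig(2), of "j + 1" l] that assms by auto
  have below': "part \<kappa> l < Fin x" if "j < l" "l \<le> N" for l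
    using upper[of l] below[of l] that kj by auto
  have inside': "part \<kappa> l = Fin x" if "k \<le> l" "l \<le> j" for l
    using part_antimono[OF sig(1) that(1)] part_antimono[OF sig(1) that(2)] assms by auto
  have inside: "part \<mu> l = Fin x" if "k < l" "l \<le> j" for l
    using upper[of l] lower[of "l - 1"] inside'[of l] inside'[of "l - 1"] that kj by auto
  show "indices \<kappa> x = {k..j}"
  proof (intro set_eqI)
    fix l
    show "l \<in> indices \<kappa> x \<longleftrightarrow> l \<in> {k..j}"
      using above'[of l] below'[of l] inside'[of l] kj
      by (cases "l < k"; cases "j < l") (auto simp: indices_iff)
  qed
  show "indices \<mu> x = {k<..j}"
  proof (intro set_eqI)
    fix l
    show "l \<in> indices \<mu> x \<longleftrightarrow> l \<in> {k<..j}"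
      using above[of l] below[of l] inside[of l] kj
      by (cases "l \<le> k"; cases "j < l") (auto simp: indices_iff)
  qed
qed

lemma psi_block_exists:
  assumes "count (mset \<kappa>) x = Suc (count (mset \<mu>) x)"
  obtains k j where "1 \<le> k" "k \<le> j" "j \<le> N"
    "part \<mu> (j + 1) < part \<kappa> j" "part \<kappa> j = Fin x" "part \<kappa> k = Fin x" "part \<kappa> k < part \<mu> k"
proof -
  have card: "card (indices \<kappa> x) = Suc (card (indices \<mu> x))" using assms by (simp add: card_indices)
  then have ne: "indices \<kappa> x \<noteq> {}" by auto
  define k where "k = Min (indices \<kappa> x)"
  define j where "j = Max (indices \<kappa> x)"
  have k: "k \<in> indices \<kappa> x" and j: "j \<in> indices \<kappa> x"
    unfolding k_def j_def using ne by (simp_all add: Min_in Max_in)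
  have kj: "k \<le> l" "l \<le> j" if "l \<in> indices \<kappa> x" for l
    unfolding k_def j_def using that by simp_all
  have k': "1 \<le> k" "k \<le> N" "part \<kappa> k = Fin x" and j': "1 \<le> j" "j \<le> N" "part \<kappa> j = Fin x"
    using k j by (simp_all add: indices_iff)
  have inside: "part \<mu> l = Fin x" if "k < l" "l \<le> j" for l
  proof -
    have "part \<kappa> l = Fin x"
      using part_antimono[OF sig(1), of l j] part_antimono[OF sig(1), of k l] that k' j' by auto
    moreover have "k \<le> l - 1" "l - 1 \<le> j" using that by simp_all
    then have "part \<kappa> (l - 1) = Fin x"
      using part_antimono[OF sig(1), of "l - 1" j] part_antimono[OF sig(1), of k "l - 1"] k' j' by auto
    ultimately show ?thesis using upper[of l] lower[of "l - 1"] that k' j' by auto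
  qed
  have sub: "indices \<kappa> x \<subseteq> {k..j}" using kj by auto
  have sup: "{k<..j} \<subseteq> indices \<mu> x" using inside k' j' by (auto simp: indices_iff)
  have "card (indices \<mu> x) \<le> j - k" using card card_mono[OF _ sub] kj(1)[OF j] by simp
  then have eq: "indices \<mu> x = {k<..j}"
    using card_seteq[OF finite_indices sup] by simp
  have "part \<mu> k \<noteq> Fin x" using eq k' by (auto simp: indices_iff set_eq_iff)
  then have 1: "part \<kappa> k < part \<mu> k" using upper[of k] k' by auto
  have 2: "part \<mu> (j + 1) < part \<kappa> j"
  proof (cases "j = N")
    case True
    then show ?thesis using j' sig by (simp add: part_def Sig_def)
  next
    case False
    have "j + 1 \<notin> indices \<mu> x" using eq by auto
    then have "part \<mu> (j + 1) \<noteq> Fin x" using j' False by (auto simp: indices_iff)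
    moreover have "part \<mu> (j + 1) \<le> part \<kappa> j" using lower[of j] j' by simp
    ultimately show ?thesis using j' by auto
  qed
  show ?thesis by (rule that[OF k'(1) kj(1)[OF j] j'(2) 2 j'(3) k'(3) 1])
qed

lemma phi_by_positions:
  "phi N t \<mu> \<kappa> = (\<Prod>x\<in>{x. count (mset \<mu>) x = Suc (count (mset \<kappa>) x)}. qnum t (count (mset \<mu>) x))"
proof -
  let ?K = "{(k, j). 1 \<le> k \<and> k \<le> j \<and> j \<le> N \<and>
          part \<kappa> j < part \<mu> j \<and> part \<mu> j = part \<mu> k \<and> part \<mu> k < part \<kappa> (k - 1)}"
  let ?S = "{x. count (mset \<mu>) x = Suc (count (mset \<kappa>) x)}"
  let ?f = "\<lambda>(k :: nat, j). \<mu> ! (j - 1)"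
  have val: "part \<mu> j = Fin (\<mu> ! (j - 1))" if "1 \<le> j" "j \<le> N" for j
    using that sig by (simp add: part_def Sig_def)
  have block: "indices \<mu> (\<mu> ! (j - 1)) = {k..j}" "indices \<kappa> (\<mu> ! (j - 1)) = {k..<j}"
    if "(k, j) \<in> ?K" for k j
    using phi_block[of k j "\<mu> ! (j - 1)"] val[of j] that by auto
  have bij: "bij_betw ?f ?K ?S"
  proof (rule bij_betw_imageI)
    show "inj_on ?f ?K"
    proof (rule inj_onI)
      fix p p' assume pp: "p \<in> ?K" "p' \<in> ?K" "?f p = ?f p'"
      obtain k j k' j' where p: "p = (k, j)" "p' = (k', j')" by fastforce
      have K: "(k, j) \<in> ?K" "(k', j') \<in> ?K" and eq: "\<mu> ! (j - 1) = \<mu> ! (j' - 1)"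
        using pp unfolding p by (simp_all only: prod.case)
      have "{k..j} = {k'..j'}" using block(1)[OF K(1)] block(1)[OF K(2)] unfolding eq by blast
      moreover have "k \<le> j" "k' \<le> j'" using K by auto
      ultimately show "p = p'" using p by (simp add: Icc_eq_Icc)
    qed
    show "?f ` ?K = ?S"
    proof (intro set_eqI iffI)
      fix x assume "x \<in> ?f ` ?K"
      then obtain k j where kj: "(k, j) \<in> ?K" "x = \<mu> ! (j - 1)" by auto
      then show "x \<in> ?S" using block[OF kj(1)] by (auto simp: card_indices[symmetric])
    next
      fix x assume "x \<in> ?S"
      then have "count (mset \<mu>) x = Suc (count (mset \<kappa>) x)" by simp
      then obtain k j where "1 \<le> k" "k \<le> j" "j \<le> N" "part \<kappa> j < part \<mu> j" "part \<mu> j = Fin x"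
        "part \<mu> k = Fin x" "part \<mu> k < part \<kappa> (k - 1)"
        by (rule phi_block_exists)
      then show "x \<in> ?f ` ?K" using val[of j] by (intro rev_image_eqI[of "(k, j)"]) auto
    qed
  qed
  have "phi N t \<mu> \<kappa> = (\<Prod>p\<in>?K. case p of (k, j) \<Rightarrow> 1 - t ^ (j - k + 1))"
    using inter by (simp add: phi_def)
  also have "\<dots> = (\<Prod>p\<in>?K. qnum t (count (mset \<mu>) (?f p)))"
  proof (intro prod.cong refl)
    fix p assume "p \<in> ?K"
    moreover obtain k j where p: "p = (k, j)" by fastforce
    ultimately have "count (mset \<mu>) (\<mu> ! (j - 1)) = j - k + 1"
      using block(1)[of k j] by (auto simp: card_indices[symmetric])
    then show "(case p of (k, j) \<Rightarrow> 1 - t ^ (j - k + 1)) = qnum t (count (mset \<mu>) (?f p))"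
      by (simp add: p qnum_def)
  qed
  also have "\<dots> = (\<Prod>x\<in>?S. qnum t (count (mset \<mu>) x))"
    by (rule prod.reindex_bij_betw[OF bij])
  finally show ?thesis .
qed

lemma psi_by_positions:
  "psi N t \<mu> \<kappa> = (\<Prod>x\<in>{x. count (mset \<kappa>) x = Suc (count (mset \<mu>) x)}. qnum t (count (mset \<kappa>) x))"
proof -
  let ?K = "{(k, j). 1 \<le> k \<and> k \<le> j \<and> j \<le> N \<and>
          part \<mu> (j + 1) < part \<kappa> j \<and> part \<kappa> j = part \<kappa> k \<and> part \<kappa> k < part \<mu> k}"
  let ?S = "{x. count (mset \<kappa>) x = Suc (count (mset \<mu>) x)}"
  let ?f = "\<lambda>(k :: nat, j). \<kappa> ! (j - 1)"
  have val: "part \<kappa> j = Fin (\<kappa> ! (j - 1))" if "1 \<le> j" "j \<le> N" for j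
    using that sig by (simp add: part_def Sig_def)
  have block: "indices \<kappa> (\<kappa> ! (j - 1)) = {k..j}" "indices \<mu> (\<kappa> ! (j - 1)) = {k<..j}"
    if "(k, j) \<in> ?K" for k j
    using psi_block[of k j "\<kappa> ! (j - 1)"] val[of j] that by auto
  have bij: "bij_betw ?f ?K ?S"
  proof (rule bij_betw_imageI)
    show "inj_on ?f ?K"
    proof (rule inj_onI)
      fix p p' assume pp: "p \<in> ?K" "p' \<in> ?K" "?f p = ?f p'"
      obtain k j k' j' where p: "p = (k, j)" "p' = (k', j')" by fastforce
      have K: "(k, j) \<in> ?K" "(k', j') \<in> ?K" and eq: "\<kappa> ! (j - 1) = \<kappa> ! (j' - 1)"
        using pp unfolding p by (simp_all only: prod.case)
      have "{k..j} = {k'..j'}" using block(1)[OF K(1)] block(1)[OF K(2)] unfolding eq by blast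
      moreover have "k \<le> j" "k' \<le> j'" using K by auto
      ultimately show "p = p'" using p by (simp add: Icc_eq_Icc)
    qed
    show "?f ` ?K = ?S"
    proof (intro set_eqI iffI)
      fix x assume "x \<in> ?f ` ?K"
      then obtain k j where kj: "(k, j) \<in> ?K" "x = \<kappa> ! (j - 1)" by auto
      then show "x \<in> ?S" using block[OF kj(1)] by (auto simp: card_indices[symmetric])
    next
      fix x assume "x \<in> ?S"
      then have "count (mset \<kappa>) x = Suc (count (mset \<mu>) x)" by simp
      then obtain k j where "1 \<le> k" "k \<le> j" "j \<le> N" "part \<mu> (j + 1) < part \<kappa> j" "part \<kappa> j = Fin x"
        "part \<kappa> k = Fin x" "part \<kappa> k < part \<mu> k"
        by (rule psi_block_exists)
      then show "x \<in> ?f ` ?K" using val[of j] by (intro rev_image_eqI[of "(k, j)"]) auto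
    qed
  qed
  have "psi N t \<mu> \<kappa> = (\<Prod>p\<in>?K. case p of (k, j) \<Rightarrow> 1 - t ^ (j - k + 1))"
    using inter by (simp add: psi_def)
  also have "\<dots> = (\<Prod>p\<in>?K. qnum t (count (mset \<kappa>) (?f p)))"
  proof (intro prod.cong refl)
    fix p assume "p \<in> ?K"
    moreover obtain k j where p: "p = (k, j)" by fastforce
    ultimately have "count (mset \<kappa>) (\<kappa> ! (j - 1)) = j - k + 1"
      using block(1)[of k j] by (auto simp: card_indices[symmetric])
    then show "(case p of (k, j) \<Rightarrow> 1 - t ^ (j - k + 1)) = qnum t (count (mset \<kappa>) (?f p))"
      by (simp add: p qnum_def)
  qed
  also have "\<dots> = (\<Prod>x\<in>?S. qnum t (count (mset \<kappa>) x))"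
    by (rule prod.reindex_bij_betw[OF bij])
  finally show ?thesis .
qed

end

section \<open>Arrays of signatures\<close>

text \<open>
Stated with additions on both sides to avoid truncated subtraction; the presence of a
particle at \<open>k\<close> is the case \<open>x = k\<close>.
\<close>

lemma moves_iff_count:
  "moves k \<kappa> \<kappa>' \<longleftrightarrow>
    (\<forall>x. count (mset \<kappa>') x + of_bool (x = k) = count (mset \<kappa>) x + of_bool (x = k + 1))"
proof
  assume "moves k \<kappa> \<kappa>'"
  then have k: "0 < count (mset \<kappa>) k" and eq: "mset \<kappa>' = add_mset (k + 1) (mset \<kappa> - {#k#})"
    unfolding moves_def by (simp_all only: count_greater_zero_iff)
  show "\<forall>x. count (mset \<kappa>') x + of_bool (x = k) = count (mset \<kappa>) x + of_bool (x = k + 1)"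
    using k unfolding eq by (auto simp del: count_mset)
next
  assume *: "\<forall>x. count (mset \<kappa>') x + of_bool (x = k) = count (mset \<kappa>) x + of_bool (x = k + 1)"
  have "count (mset \<kappa>) k = Suc (count (mset \<kappa>') k)" using spec[OF *, of k] by simp
  then have k: "0 < count (mset \<kappa>) k" by (simp only: zero_less_Suc)
  moreover have "mset \<kappa>' = add_mset (k + 1) (mset \<kappa> - {#k#})"
  proof (rule multiset_eqI)
    fix x
    show "count (mset \<kappa>') x = count (add_mset (k + 1) (mset \<kappa> - {#k#})) x"
      using spec[OF *, of x] k by (auto simp del: count_mset split: if_splits)
  qed
  ultimately show "moves k \<kappa> \<kappa>'" unfolding moves_def by (simp only: count_greater_zero_iff)
qed

lemma moved_pos_eq:
  assumes "moves k \<kappa> \<kappa>'"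
  shows "moved_pos \<kappa> \<kappa>' = k"
  unfolding moved_pos_def
proof (rule the_equality)
  show "moves k \<kappa> \<kappa>'" by (rule assms)
next
  fix l assume "moves l \<kappa> \<kappa>'"
  then show "l = k"
    using assms[unfolded moves_iff_count, rule_format, of k]
    by (cases "l = k") (auto simp: moves_iff_count simp del: count_mset dest: spec[of _ k])
qed

lemma count_neg: "count (mset (neg \<kappa>)) x = count (mset \<kappa>) (- x)"
proof -
  have "mset (neg \<kappa>) = image_mset uminus (mset \<kappa>)" by (simp add: neg_def)
  moreover have "count (image_mset uminus A) x = count A (- x)" for A :: "int multiset"
    by (induction A) auto
  ultimately show ?thesis by simp
qed

lemma neg_neg: "neg (neg \<kappa>) = \<kappa>"
  by (simp add: neg_def rev_map comp_def)

lemma neg_Sig: "\<kappa> \<in> Sig N \<Longrightarrow> neg \<kappa> \<in> Sig N"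
  by (simp add: Sig_def neg_def sorted_wrt_map sorted_wrt_rev)

lemma weight_neg: "weight (neg \<kappa>) = - weight \<kappa>"
proof -
  have "sum_list (map uminus xs) = - sum_list xs" for xs :: "int list" by (induction xs) auto
  then show ?thesis by (simp add: weight_def neg_def)
qed

lemma part_neg:
  assumes "1 \<le> k" "k \<le> length \<kappa>"
  shows "part (neg \<kappa>) k = Fin (- \<kappa> ! (length \<kappa> - k))"
  using assms by (simp add: part_def neg_def rev_nth)

lemma interlaces_neg:
  assumes "interlaces \<kappa> \<mu>"
  shows "interlaces (neg \<mu>) (neg \<kappa>)"
proof -
  have len: "length \<kappa> = length \<mu>" using assms by (simp add: interlaces_def)
  have up: "\<kappa> ! l \<le> \<mu> ! l" if "l < length \<mu>" for l
    using assms that len unfolding interlaces_def by (force simp: part_def dest: bspec[of _ _ "Suc l"])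
  have low: "\<mu> ! (Suc l) \<le> \<kappa> ! l" if "Suc l < length \<mu>" for l
    using assms that len unfolding interlaces_def by (force simp: part_def dest: bspec[of _ _ "Suc l"])
  have "part (neg \<mu>) k \<le> part (neg \<kappa>) k \<and> part (neg \<kappa>) (k + 1) \<le> part (neg \<mu>) k"
    if k: "1 \<le> k" "k \<le> length \<mu>" for k
  proof
    show "part (neg \<mu>) k \<le> part (neg \<kappa>) k"
      using part_neg[of k \<kappa>] part_neg[of k \<mu>] k len up[of "length \<mu> - k"] by simp
    show "part (neg \<kappa>) (k + 1) \<le> part (neg \<mu>) k"
    proof (cases "k = length \<mu>")
      case True
      then show ?thesis using len by (simp add: part_def neg_def)
    next
      case False
      then have "Suc (length \<mu> - (k + 1)) = length \<mu> - k" using k by simp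
      then show ?thesis
        using part_neg[of "k + 1" \<kappa>] part_neg[of k \<mu>] k len False low[of "length \<mu> - (k + 1)"] by simp
    qed
  qed
  then show ?thesis using len by (simp add: interlaces_def neg_def)
qed

lemma interlaces_weight:
  assumes "interlaces \<kappa> \<mu>"
  shows "weight \<kappa> \<le> weight \<mu>"
proof -
  have len: "length \<kappa> = length \<mu>" using assms by (simp add: interlaces_def)
  have "\<kappa> ! l \<le> \<mu> ! l" if "l < length \<mu>" for l
    using assms that len unfolding interlaces_def by (force simp: part_def dest: bspec[of _ _ "Suc l"])
  then show ?thesis
    unfolding weight_def sum_list_sum_nth len by (intro sum_mono) simp
qed

definition counts :: "array \<Rightarrow> int \<Rightarrow> int \<Rightarrow> int \<Rightarrow> nat" where
  "counts \<Lambda> i j = count (mset (\<Lambda> i j))"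

lemma admissible_grid:
  assumes adm: "admissible N m n \<mu> \<rho> \<kappa> \<nu> \<Lambda>" and mn: "0 \<le> m" "0 \<le> n"
  shows "increment_grid m n (hpos \<Lambda>) (vpos \<Lambda>) (counts \<Lambda>)"
proof
  note adm' = adm[unfolded admissible_def]
  have hm: "moves (hpos \<Lambda> i j) (\<Lambda> i j) (\<Lambda> (i + 1) j)" if "0 \<le> i" "i < m" "0 \<le> j" "j \<le> n" for i j
  proof -
    obtain k where "moves k (\<Lambda> i j) (\<Lambda> (i + 1) j)" using adm' \<open>0 \<le> i\<close> \<open>i < m\<close> \<open>0 \<le> j\<close> \<open>j \<le> n\<close> by force
    then show ?thesis unfolding hpos_def using moved_pos_eq by simp
  qed
  have vm: "moves (vpos \<Lambda> i j) (\<Lambda> i j) (\<Lambda> i (j + 1))" if "0 \<le> i" "i \<le> m" "0 \<le> j" "j < n" for i j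
  proof -
    obtain k where "moves k (\<Lambda> i j) (\<Lambda> i (j + 1))" using adm' \<open>0 \<le> i\<close> \<open>i \<le> m\<close> \<open>0 \<le> j\<close> \<open>j < n\<close> by force
    then show ?thesis unfolding vpos_def using moved_pos_eq by simp
  qed
  fix i j x
  show "counts \<Lambda> (i + 1) j x + of_bool (x = hpos \<Lambda> i j) = counts \<Lambda> i j x + of_bool (x = hpos \<Lambda> i j + 1)"
    if "0 \<le> i" "i < m" "0 \<le> j" "j \<le> n"
    using hm[OF that] unfolding moves_iff_count counts_def by blast
  show "counts \<Lambda> i (j + 1) x + of_bool (x = vpos \<Lambda> i j) = counts \<Lambda> i j x + of_bool (x = vpos \<Lambda> i j + 1)"
    if "0 \<le> i" "i \<le> m" "0 \<le> j" "j < n"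
    using vm[OF that] unfolding moves_iff_count counts_def by blast
next
  fix i j
  show "hpos \<Lambda> i j < hpos \<Lambda> (i + 1) j" if "0 \<le> i" "i + 1 < m" "0 \<le> j" "j \<le> n"
    using adm that unfolding admissible_def by simp
  show "vpos \<Lambda> i j < vpos \<Lambda> i (j + 1)" if "0 \<le> i" "i \<le> m" "0 \<le> j" "j + 1 < n"
    using adm that unfolding admissible_def by simp
  show "hpos \<Lambda> i (j + 1) = hpos \<Lambda> i j \<or> hpos \<Lambda> i (j + 1) = hpos \<Lambda> i j + 1"
    if "0 \<le> i" "i < m" "0 \<le> j" "j < n" "hpos \<Lambda> i j = vpos \<Lambda> i j"
  proof -
    have "\<forall>i\<in>{0..<m}. \<forall>j\<in>{0..<n}. \<forall>k. hpos \<Lambda> i j = k \<and> vpos \<Lambda> i j = k \<longrightarrow>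
        hpos \<Lambda> i (j + 1) = vpos \<Lambda> (i + 1) j \<and> hpos \<Lambda> i (j + 1) \<in> {k, k + 1}"
      using adm unfolding admissible_def by blast
    from this[rule_format, of i j "hpos \<Lambda> i j"] show ?thesis using that by auto
  qed
qed (use mn in auto)

text \<open>
The converse of \<open>admissible_grid\<close>: positions and admissibility of an array can be read off its
particle numbers. Applied to the reversed grid, it yields the admissibility of the turned array.
\<close>

lemma (in increment_grid) array_of_grid:
  assumes S: "\<And>i j. 0 \<le> i \<Longrightarrow> i \<le> m \<Longrightarrow> 0 \<le> j \<Longrightarrow> j \<le> n \<Longrightarrow> \<Lambda> i j \<in> Sig N"
    and C: "\<And>i j. 0 \<le> i \<Longrightarrow> i \<le> m \<Longrightarrow> 0 \<le> j \<Longrightarrow> j \<le> n \<Longrightarrow> counts \<Lambda> i j = M i j"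
  shows "\<And>i j. 0 \<le> i \<Longrightarrow> i < m \<Longrightarrow> 0 \<le> j \<Longrightarrow> j \<le> n \<Longrightarrow> hpos \<Lambda> i j = h i j"
    and "\<And>i j. 0 \<le> i \<Longrightarrow> i \<le> m \<Longrightarrow> 0 \<le> j \<Longrightarrow> j < n \<Longrightarrow> vpos \<Lambda> i j = v i j"
    and "admissible N m n (\<Lambda> 0 n) (\<Lambda> m n) (\<Lambda> 0 0) (\<Lambda> m 0) \<Lambda>"
proof -
  have hm: "moves (h i j) (\<Lambda> i j) (\<Lambda> (i + 1) j)" if "0 \<le> i" "i < m" "0 \<le> j" "j \<le> n" for i j
    using hstep[OF that] C[of i j] C[of "i + 1" j] that
    unfolding moves_iff_count counts_def by simp
  have vm: "moves (v i j) (\<Lambda> i j) (\<Lambda> i (j + 1))" if "0 \<le> i" "i \<le> m" "0 \<le> j" "j < n" for i j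
    using vstep[OF that] C[of i j] C[of i "j + 1"] that
    unfolding moves_iff_count counts_def by simp
  show hp: "hpos \<Lambda> i j = h i j" if "0 \<le> i" "i < m" "0 \<le> j" "j \<le> n" for i j
    unfolding hpos_def by (rule moved_pos_eq[OF hm[OF that]])
  show vp: "vpos \<Lambda> i j = v i j" if "0 \<le> i" "i \<le> m" "0 \<le> j" "j < n" for i j
    unfolding vpos_def by (rule moved_pos_eq[OF vm[OF that]])
  show "admissible N m n (\<Lambda> 0 n) (\<Lambda> m n) (\<Lambda> 0 0) (\<Lambda> m 0) \<Lambda>"
    unfolding admissible_def
  proof (intro conjI ballI refl allI impI)
    fix i j assume "i \<in> {0..<m}" "j \<in> {0..n}"
    then show "\<exists>k. moves k (\<Lambda> i j) (\<Lambda> (i + 1) j)" using hm[of i j] by auto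
  next
    fix i j assume "i \<in> {0..m}" "j \<in> {0..<n}"
    then show "\<exists>k. moves k (\<Lambda> i j) (\<Lambda> i (j + 1))" using vm[of i j] by auto
  next
    fix i j assume "i \<in> {0..<m - 1}" "j \<in> {0..n}"
    then show "hpos \<Lambda> i j < hpos \<Lambda> (i + 1) j" using hmono[of i j] hp by simp
  next
    fix i j assume "i \<in> {0..m}" "j \<in> {0..<n - 1}"
    then show "vpos \<Lambda> i j < vpos \<Lambda> i (j + 1)" using vmono[of i j] vp by simp
  next
    fix i j k assume "i \<in> {0..<m}" "j \<in> {0..<n}" and k: "hpos \<Lambda> i j = k \<and> vpos \<Lambda> i j = k"
    then have r: "0 \<le> i" "i < m" "0 \<le> j" "j < n" by simp_all
    then have "hpos \<Lambda> i j = h i j" "vpos \<Lambda> i j = v i j" "hpos \<Lambda> i (j + 1) = h i (j + 1)"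
      "vpos \<Lambda> (i + 1) j = v (i + 1) j" using hp vp by simp_all
    then show "hpos \<Lambda> i (j + 1) = vpos \<Lambda> (i + 1) j" "hpos \<Lambda> i (j + 1) \<in> {k, k + 1}"
      using box_alternatives[OF r] box[OF r] k by auto
  qed (use S in auto)
qed

lemma admissible_reversed:
  assumes adm: "admissible N m n \<mu> \<rho> \<kappa> \<nu> \<Lambda>" and mn: "0 \<le> m" "0 \<le> n"
  defines "\<Lambda>' \<equiv> \<lambda>i j. neg (\<Lambda> (m - i) (n - j))"
  shows "admissible N m n (neg \<nu>) (neg \<kappa>) (neg \<rho>) (neg \<mu>) \<Lambda>'"
    and "\<And>i j. 0 \<le> i \<Longrightarrow> i < m \<Longrightarrow> 0 \<le> j \<Longrightarrow> j \<le> n \<Longrightarrow> hpos \<Lambda>' i j = - 1 - hpos \<Lambda> (m - 1 - i) (n - j)"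
    and "\<And>i j. 0 \<le> i \<Longrightarrow> i \<le> m \<Longrightarrow> 0 \<le> j \<Longrightarrow> j < n \<Longrightarrow> vpos \<Lambda>' i j = - 1 - vpos \<Lambda> (m - i) (n - 1 - j)"
    and "\<And>i j. counts \<Lambda>' i j = (\<lambda>x. counts \<Lambda> (m - i) (n - j) (- x))"
proof -
  interpret G: increment_grid m n "hpos \<Lambda>" "vpos \<Lambda>" "counts \<Lambda>" by (rule admissible_grid[OF adm mn])
  interpret R: increment_grid m n "\<lambda>i j. - 1 - hpos \<Lambda> (m - 1 - i) (n - j)"
    "\<lambda>i j. - 1 - vpos \<Lambda> (m - i) (n - 1 - j)" "\<lambda>i j x. counts \<Lambda> (m - i) (n - j) (- x)"
    by (rule G.reversed)
  show C: "counts \<Lambda>' i j = (\<lambda>x. counts \<Lambda> (m - i) (n - j) (- x))" for i j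
    unfolding \<Lambda>'_def counts_def using count_neg by blast
  have S: "\<Lambda>' i j \<in> Sig N" if "0 \<le> i" "i \<le> m" "0 \<le> j" "j \<le> n" for i j
    unfolding \<Lambda>'_def using adm that by (intro neg_Sig) (simp add: admissible_def)
  show "hpos \<Lambda>' i j = - 1 - hpos \<Lambda> (m - 1 - i) (n - j)" if "0 \<le> i" "i < m" "0 \<le> j" "j \<le> n" for i j
    using R.array_of_grid(1)[OF S C] that by blast
  show "vpos \<Lambda>' i j = - 1 - vpos \<Lambda> (m - i) (n - 1 - j)" if "0 \<le> i" "i \<le> m" "0 \<le> j" "j < n" for i j
    using R.array_of_grid(2)[OF S C] that by blast
  have "\<Lambda>' 0 n = neg \<nu>" "\<Lambda>' m n = neg \<kappa>" "\<Lambda>' 0 0 = neg \<rho>" "\<Lambda>' m 0 = neg \<mu>"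
    using adm unfolding \<Lambda>'_def admissible_def by simp_all
  then show "admissible N m n (neg \<nu>) (neg \<kappa>) (neg \<rho>) (neg \<mu>) \<Lambda>'"
    using R.array_of_grid(3)[OF S C] by simp
qed

text \<open>
The grid data need to agree with those of the array only inside the rectangle, since the positions
of moves outside it are unspecified. This lets the lemma be used for the turned array and for any
array chosen in the definition of \<open>U\<close>.
\<close>

lemma (in weighted_grid) box_weight_eq_in_weight:
  assumes H: "\<And>i j. 0 \<le> i \<Longrightarrow> i < m \<Longrightarrow> 0 \<le> j \<Longrightarrow> j \<le> n \<Longrightarrow> hpos \<Lambda> i j = h i j"
    and V: "\<And>i j. 0 \<le> i \<Longrightarrow> i \<le> m \<Longrightarrow> 0 \<le> j \<Longrightarrow> j < n \<Longrightarrow> vpos \<Lambda> i j = v i j"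
    and C: "\<And>i j. 0 \<le> i \<Longrightarrow> i \<le> m \<Longrightarrow> 0 \<le> j \<Longrightarrow> j \<le> n \<Longrightarrow> counts \<Lambda> i j = M i j"
    and r: "0 \<le> i" "i < m" "0 \<le> j" "j < n"
  shows "box_weight t m n \<Lambda> i j = in_weight i j"
proof -
  have Z: "zero_box m n \<Lambda> i j \<longleftrightarrow> zero i j" for i j
    using zeroD(8)[of i j] H[of i j] H[of i "j + 1"] V[of i j] V[of "i + 1" j]
    unfolding zero_box_def zero_def by auto
  have O1: "one_box m n \<Lambda> i j \<longleftrightarrow> one i j" for i j
    using oneD(8)[of i j] H[of i j] H[of i "j + 1"] V[of i j] V[of "i + 1" j]
    unfolding one_box_def one_def by auto
  have T: "trivial_box m n \<Lambda> i j \<longleftrightarrow> \<not> zero i j \<and> \<not> one i j" for i j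
    unfolding trivial_box_def Z O1 by simp
  have c: "box_c t \<Lambda> i j = t ^ M i j (h i j)"
    using C[of i j] H[of i j] r by (simp add: box_c_def box_r_def counts_def)
  have rr: "box_r \<Lambda> i j = h i j" using H[of i j] r by (simp add: box_r_def)
  show ?thesis
  proof (cases "zero i j \<or> one i j")
    case False
    then have "\<not> mixed_diag (i - 1) (j - 1)" "in_factor i j = 1" by (simp_all add: mixed_diag_def in_factor_def)
    with False show ?thesis by (simp add: box_weight_def Let_def T in_weight_def)
  next
    case nt: True
    have w: "v i j = h i j" using nt zeroD(6) oneD(6) by blast
    have hl: "hpos_ext \<Lambda> (i - 1) j = Fin (h i j - 1) \<longleftrightarrow> lefthit i j"
      "hpos_ext \<Lambda> (i - 1) j < Fin (h i j - 1) \<longleftrightarrow> \<not> lefthit i j"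
      using H[of "i - 1" j] hmono[of "i - 1" j] r by (auto simp: hpos_ext_def lefthit_def)
    have vl: "vpos_ext \<Lambda> i (j - 1) = Fin (h i j - 1) \<longleftrightarrow> lowhit i j"
      "vpos_ext \<Lambda> i (j - 1) < Fin (h i j - 1) \<longleftrightarrow> \<not> lowhit i j"
      using V[of i "j - 1"] vmono[of i "j - 1"] r w by (auto simp: vpos_ext_def lowhit_def)
    have d: "box_rbar \<Lambda> (i - 1) (j - 1) = h i j - 1 \<longleftrightarrow> link (i - 1) (j - 1)"
      if "zero (i - 1) (j - 1) \<or> one (i - 1) (j - 1)"
    proof -
      have "0 \<le> i - 1" using that zeroD(1) oneD(1) by blast
      then show ?thesis using H[of "i - 1" j] r by (auto simp: box_rbar_def link_def)
    qed
    \<comment> \<open>All references to neighbouring boxes and edges become statements about hits and diagonal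
      pairs; both hits together mean a diagonal predecessor.\<close>
    have bw: "box_weight t m n \<Lambda> i j =
      (if one i j \<and> (one (i - 1) j \<or> one i (j - 1)) \<or> one_diag (i - 1) (j - 1) \<or> zero_diag (i - 1) (j - 1) then 1
       else if zero i j \<and> lefthit i j \<noteq> lowhit i j then t
       else if one i j \<and> (\<not> zero (i - 1) j \<and> \<not> one (i - 1) j) \<and> (\<not> zero i (j - 1) \<and> \<not> one i (j - 1)) \<and>
         lefthit i j \<noteq> lowhit i j then 1 - t
       else if zero i j \<and> \<not> lefthit i j \<and> \<not> lowhit i j then (t - t ^ M i j (h i j)) / (1 - t ^ M i j (h i j))
       else if one i j \<and> \<not> lefthit i j \<and> \<not> lowhit i j then (1 - t) / (1 - t ^ M i j (h i j))
       else 0)"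
    proof -
      have "one i j \<and> one (i - 1) (j - 1) \<and> box_rbar \<Lambda> (i - 1) (j - 1) = h i j - 1 \<longleftrightarrow> one_diag (i - 1) (j - 1)"
        "zero i j \<and> zero (i - 1) (j - 1) \<and> box_rbar \<Lambda> (i - 1) (j - 1) = h i j - 1 \<longleftrightarrow> zero_diag (i - 1) (j - 1)"
        using d by (auto simp: one_diag_def zero_diag_def)
      moreover have "(\<not> zero i j \<and> \<not> one i j) = False" using nt by blast
      ultimately show ?thesis
        unfolding box_weight_def Let_def Z O1 T c rr hl vl by (simp only: simp_thms)
    qed
    have both: "lefthit i j \<and> lowhit i j \<longleftrightarrow>
      one_diag (i - 1) (j - 1) \<or> zero_diag (i - 1) (j - 1) \<or> mixed_diag (i - 1) (j - 1)"
    proof -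
      have "one_diag (i - 1) (j - 1) \<or> zero_diag (i - 1) (j - 1) \<or> mixed_diag (i - 1) (j - 1) \<longleftrightarrow>
        (zero (i - 1) (j - 1) \<or> one (i - 1) (j - 1)) \<and> link (i - 1) (j - 1)"
        using nt unfolding one_diag_def zero_diag_def mixed_diag_def diff_add_cancel by blast
      then show ?thesis using both_hits_diagonal[of i j] diagonal_hits[of i j] nt by blast
    qed
    show ?thesis
    proof (cases "zero i j")
      case zero: True
      then have no: "\<not> one i j" "\<not> one_diag (i - 1) (j - 1)" using zeroD(5) by (auto simp: one_diag_def)
      have M1: "M i j (h i j) = Suc (M i j (h i j) - 1)" using count_after_zero(3)[OF zero] by simp
      have G: "t * in_factor i j = (t - t ^ M i j (h i j)) / (1 - t ^ M i j (h i j))"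
        using zero M1 by (simp add: in_factor_def qnum_def Let_def right_diff_distrib power_Suc[symmetric] del: power_Suc)
      have "\<not> (zero_diag (i - 1) (j - 1) \<and> mixed_diag (i - 1) (j - 1))"
        using zeroD(5) unfolding zero_diag_def mixed_diag_def by blast
      then show ?thesis
        unfolding bw in_weight_def using zero no both G[symmetric] by auto
    next
      case False
      then have one: "one i j" using nt by simp
      have no: "\<not> zero (i - 1) j" "\<not> zero i (j - 1)" using zero_left zero_below one by blast+
      have left: "lefthit i j" if "one (i - 1) j"
        using one_left(2)[OF that] oneD(1)[OF that] one by (simp add: lefthit_def)
      have low: "lowhit i j" if "one i (j - 1)"
        using one_below(2)[OF that] oneD(3)[OF that] one by (simp add: lowhit_def)
      have nomis: "\<not> mixed_diag (i - 1) (j - 1)" if "one (i - 1) j \<or> one i (j - 1)"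
        using that zero_below(2)[of "i - 1" j] zero_left(2)[of i "j - 1"] False unfolding mixed_diag_def by auto
      have no_zz: "\<not> zero_diag (i - 1) (j - 1)" using False by (simp add: zero_diag_def)
      have excl: "\<not> (one_diag (i - 1) (j - 1) \<and> mixed_diag (i - 1) (j - 1))"
        using oneD(5) unfolding one_diag_def mixed_diag_def by blast
      have G: "in_factor i j = 1 / (1 - t ^ M i j (h i j))"
        using one False by (simp add: in_factor_def qnum_def Let_def)
      show ?thesis
        unfolding bw in_weight_def G using one False no left low nomis no_zz excl both by auto
    qed
  qed
qed

text \<open>
By uniqueness of the grid, the array selected in the definition of \<open>U\<close> may be replaced by any
admissible one.
\<close>

lemma U_eq_prod_in_weight:
  assumes inter: "interlaces \<kappa> \<mu>" "interlaces \<mu> \<rho>" "interlaces \<kappa> \<nu>" "interlaces \<nu> \<rho>"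
    and weights: "weight \<nu> - weight \<kappa> = m" "weight \<rho> - weight \<mu> = m" "weight \<mu> - weight \<kappa> = n"
    and adm: "admissible N m n \<mu> \<rho> \<kappa> \<nu> \<Lambda>"
    and grid: "weighted_grid m n h v M t"
    and H: "\<And>i j. 0 \<le> i \<Longrightarrow> i < m \<Longrightarrow> 0 \<le> j \<Longrightarrow> j \<le> n \<Longrightarrow> hpos \<Lambda> i j = h i j"
    and V: "\<And>i j. 0 \<le> i \<Longrightarrow> i \<le> m \<Longrightarrow> 0 \<le> j \<Longrightarrow> j < n \<Longrightarrow> vpos \<Lambda> i j = v i j"
    and C: "\<And>i j. 0 \<le> i \<Longrightarrow> i \<le> m \<Longrightarrow> 0 \<le> j \<Longrightarrow> j \<le> n \<Longrightarrow> counts \<Lambda> i j = M i j"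
  shows "U N t \<mu> \<rho> \<kappa> \<nu> = (\<Prod>i\<in>{0..<m}. \<Prod>j\<in>{0..<n}. weighted_grid.in_weight m n h v M t i j)"
proof -
  interpret G: weighted_grid m n h v M t by (rule grid)
  define \<Lambda>' where "\<Lambda>' = (SOME \<Lambda>. admissible N m n \<mu> \<rho> \<kappa> \<nu> \<Lambda>)"
  have adm': "admissible N m n \<mu> \<rho> \<kappa> \<nu> \<Lambda>'" unfolding \<Lambda>'_def using adm
    by (rule someI[of "admissible N m n \<mu> \<rho> \<kappa> \<nu>" \<Lambda>])
  have corners: "counts \<Lambda>' 0 0 = counts \<Lambda> 0 0" "counts \<Lambda>' m 0 = counts \<Lambda> m 0"
    "counts \<Lambda>' 0 n = counts \<Lambda> 0 n" "counts \<Lambda>' m n = counts \<Lambda> m n"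
    using adm adm' unfolding admissible_def counts_def by simp_all
  note mn = G.m_nonneg G.n_nonneg
  note same = grid_determined[OF admissible_grid[OF adm' mn] admissible_grid[OF adm mn] corners]
  have "U N t \<mu> \<rho> \<kappa> \<nu> = (\<Prod>i\<in>{0..<m}. \<Prod>j\<in>{0..<n}. box_weight t m n \<Lambda>' i j)"
    using inter weights adm unfolding U_def \<Lambda>'_def by (auto simp: Let_def)
  also have "\<dots> = (\<Prod>i\<in>{0..<m}. \<Prod>j\<in>{0..<n}. G.in_weight i j)"
  proof (intro prod.cong refl)
    fix i j assume "i \<in> {0..<m}" "j \<in> {0..<n}"
    then show "box_weight t m n \<Lambda>' i j = G.in_weight i j"
      using same H V C by (intro G.box_weight_eq_in_weight) simp_all
  qed
  finally show ?thesis .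
qed

lemma U_not_admissible:
  assumes "\<not> (\<exists>\<Lambda>. admissible N (weight \<nu> - weight \<kappa>) (weight \<mu> - weight \<kappa>) \<mu> \<rho> \<kappa> \<nu> \<Lambda>)"
  shows "U N t \<mu> \<rho> \<kappa> \<nu> = 0"
  unfolding U_def Let_def using assms by (simp only: simp_thms if_False)

theorem proposition3p7:
  fixes t :: real and N :: nat and lam \<mu> \<nu> \<rho> :: sig
  assumes "0 \<le> t" and "t < 1" and "N \<ge> 1"
    and "lam \<in> Sig N" and "\<mu> \<in> Sig N" and "\<nu> \<in> Sig N" and "\<rho> \<in> Sig N"
    and "interlaces lam \<mu>" and "interlaces \<mu> \<rho>"
    and "interlaces lam \<nu>" and "interlaces \<nu> \<rho>"
    and "weight \<nu> - weight lam = weight \<rho> - weight \<mu>"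
  shows "U N t \<mu> \<rho> lam \<nu> * ((phi N t \<nu> lam * psi N t \<mu> lam) / (phi N t \<rho> \<mu> * psi N t \<rho> \<nu>))
       = U N t (neg \<nu>) (neg lam) (neg \<rho>) (neg \<mu>)"
proof -
  define m where "m = weight \<nu> - weight lam"
  define n where "n = weight \<mu> - weight lam"
  have mn: "0 \<le> m" "0 \<le> n"
    using interlaces_weight assms(8,10) by (simp_all add: m_def n_def)
  have weights: "weight \<nu> - weight lam = m" "weight \<rho> - weight \<mu> = m" "weight \<mu> - weight lam = n"
    using assms(12) by (simp_all add: m_def n_def)
  have weights': "weight (neg \<mu>) - weight (neg \<rho>) = m" "weight (neg lam) - weight (neg \<nu>) = m"
    "weight (neg \<nu>) - weight (neg \<rho>) = n"
    using weights by (simp_all add: weight_neg)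
  note inter' = assms(8-11)[THEN interlaces_neg]
  show ?thesis
  proof (cases "\<exists>\<Lambda>. admissible N m n \<mu> \<rho> lam \<nu> \<Lambda>")
    case False
    have "\<not> (\<exists>\<Lambda>. admissible N m n (neg \<nu>) (neg lam) (neg \<rho>) (neg \<mu>) \<Lambda>)"
    proof
      assume "\<exists>\<Lambda>. admissible N m n (neg \<nu>) (neg lam) (neg \<rho>) (neg \<mu>) \<Lambda>"
      then obtain \<Lambda> where "admissible N m n (neg \<nu>) (neg lam) (neg \<rho>) (neg \<mu>) \<Lambda>" by blast
      from admissible_reversed(1)[OF this mn] False show False unfolding neg_neg by blast
    qed
    then have "U N t (neg \<nu>) (neg lam) (neg \<rho>) (neg \<mu>) = 0"
      by (intro U_not_admissible) (simp only: weights' not_False_eq_True)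
    moreover have "U N t \<mu> \<rho> lam \<nu> = 0"
      using False by (intro U_not_admissible) (simp only: weights not_False_eq_True)
    ultimately show ?thesis by simp
  next
    case True
    then obtain \<Lambda> where adm: "admissible N m n \<mu> \<rho> lam \<nu> \<Lambda>" by blast
    interpret G: weighted_grid m n "hpos \<Lambda>" "vpos \<Lambda>" "counts \<Lambda>" t
      using admissible_grid[OF adm mn] assms(1,2) by (simp add: weighted_grid_def weighted_grid_axioms_def)
    let ?h = "\<lambda>i j. - 1 - hpos \<Lambda> (m - 1 - i) (n - j)"
    let ?v = "\<lambda>i j. - 1 - vpos \<Lambda> (m - i) (n - 1 - j)"
    let ?M = "\<lambda>i j x. counts \<Lambda> (m - i) (n - j) (- x)"
    have rev: "weighted_grid m n ?h ?v ?M t"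
      using G.reversed assms(1,2) by (simp add: weighted_grid_def weighted_grid_axioms_def)
    have U: "U N t \<mu> \<rho> lam \<nu> = (\<Prod>i\<in>{0..<m}. \<Prod>j\<in>{0..<n}. G.in_weight i j)"
      by (rule U_eq_prod_in_weight[OF assms(8-11) weights adm G.weighted_grid_axioms]) simp_all
    have "U N t (neg \<nu>) (neg lam) (neg \<rho>) (neg \<mu>) =
        (\<Prod>i\<in>{0..<m}. \<Prod>j\<in>{0..<n}. weighted_grid.in_weight m n ?h ?v ?M t i j)"
      by (rule U_eq_prod_in_weight[OF inter'(4,3,2,1) weights' admissible_reversed(1)[OF adm mn] rev])
        (simp_all add: admissible_reversed(2-4)[OF adm mn])
    also have "\<dots> = (\<Prod>i\<in>{0..<m}. \<Prod>j\<in>{0..<n}. weighted_grid.in_weight m n ?h ?v ?M t (m - 1 - i) (n - 1 - j))"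
      by (rule double_prod_reverse)
    also have "\<dots> = (\<Prod>i\<in>{0..<m}. \<Prod>j\<in>{0..<n}. G.out_weight i j)"
      by (intro prod.cong refl G.in_weight_reversed)
    finally have U': "U N t (neg \<nu>) (neg lam) (neg \<rho>) (neg \<mu>) = (\<Prod>i\<in>{0..<m}. \<Prod>j\<in>{0..<n}. G.out_weight i j)" .
    have corners: "counts \<Lambda> 0 0 = count (mset lam)" "counts \<Lambda> m 0 = count (mset \<nu>)"
      "counts \<Lambda> 0 n = count (mset \<mu>)" "counts \<Lambda> m n = count (mset \<rho>)"
      using adm unfolding counts_def admissible_def by simp_all
    have pair: "interlacing_pair N lam \<nu>" "interlacing_pair N \<mu> \<rho>" "interlacing_pair N lam \<mu>" "interlacing_pair N \<nu> \<rho>"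
      using assms by (simp_all add: interlacing_pair_def)
    have phi: "phi N t \<nu> lam = G.rowphi 0" "phi N t \<rho> \<mu> = G.rowphi n"
      using G.rowphi_by_positions[OF order_refl mn(2)] G.rowphi_by_positions[OF mn(2) order_refl]
        interlacing_pair.phi_by_positions[OF pair(1)] interlacing_pair.phi_by_positions[OF pair(2)]
      unfolding corners by simp_all
    have psi: "psi N t \<mu> lam = G.colpsi 0" "psi N t \<rho> \<nu> = G.colpsi m"
      using G.colpsi_by_positions[OF order_refl mn(1)] G.colpsi_by_positions[OF mn(1) order_refl]
        interlacing_pair.psi_by_positions[OF pair(3)] interlacing_pair.psi_by_positions[OF pair(4)]
      unfolding corners by simp_all
    have "G.rowphi n * G.colpsi m \<noteq> 0"
      using G.rowphi_nonzero[OF mn(2) order_refl] G.colpsi_nonzero[OF mn(1) order_refl] by simp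
    then show ?thesis
      unfolding U U' phi psi times_divide_eq_right G.weights_balance
      by (rule nonzero_mult_div_cancel_left)
  qed
qed

end
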